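(* Let $\omega$ and $\sigma$ be weight functions. Then the following are equivalent: (i) $\omega\preceq\sigma$, i.e. $\sigma(t)=O(\omega(t))$ as $t\to\infty$; (ii) $\mathcal{S}_{\{\omega\}}(\mathbb{R}^d)\subseteq\mathcal{S}_{\{\sigma\}}(\mathbb{R}^d)$ holds for all dimensions $d\in\mathbb{N}$ with continuous inclusion. More precisely, the spaces in (ii) can be defined by joint or separated growth at infinity; (i)$\Rightarrow$(ii) is valid for general weight functions $\omega$ and $\sigma$; and for (ii)$\Rightarrow$(i) only the inclusion for $d=1$ is required.
   Context: $\mathbb{N}_0=\mathbb{N}\cup\{0\}$. A weight function is a continuous increasing (i.e. nondecreasing) function $\omega:[0,+\infty)\to[0,+\infty)$ such that: $(\alpha)$ there is $L\ge 1$ with $\omega(2t)\le L(\omega(t)+1)$ for all $t\ge 0$; $(\beta)$ $\omega(t)=O(t^2)$ as $t\to+\infty$; $(\gamma)$ $\log t=o(\omega(t))$ as $t\to+\infty$; $(\delta)$ $\varphi_\omega(t):=\omega(e^t)$ is convex on $[0,+\infty)$. A general weight function satisfies all these properties except possibly $(\beta)$. The Young conjugate is $\varphi^*_\omega(s):=\sup_{t\ge 0}\{ts-\varphi_\omega(t)\}$, $s\ge 0$, and $W^{(\lambda)}_\alpha:=e^{\frac1\lambda\varphi^*_\omega(\lambda|\alpha|)}$ for $\lambda>0$, $\alpha\in\mathbb{N}_0^d$. $\mathcal{S}_{\{\omega\}}(\mathbb{R}^d)$ is the space of all $f\in C^\infty(\mathbb{R}^d)$ for which there is $\lambda>0$ with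 $\sup_{\alpha,\beta\in\mathbb{N}_0^d}\|x^\alpha\partial^\beta f\|_\infty/W^{(\lambda)}_{\alpha+\beta}<\infty$, with the inductive limit topology over $\lambda$ ($\|\cdot\|_\infty$ is the supremum norm on $\mathbb{R}^d$). This is the definition by joint growth at infinity; in the definition by separated growth at infinity, $W^{(\lambda)}_{\alpha+\beta}$ is replaced by $W^{(\lambda)}_\alpha W^{(\lambda)}_\beta$. *)

theory Defs
  imports "HOL-Analysis.Analysis" "HOL-Library.Landau_Symbols"
begin

section \<open>Weight functions\<close>

text \<open>
  Functions on \<open>[0,\<infinity>)\<close> are modelled by functions on the reals of which only the values on
  \<open>{0..}\<close> are constrained. ``Increasing'' means nondecreasing.
\<close>

definition general_weight_function :: "(real \<Rightarrow> real) \<Rightarrow> bool" where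
  "general_weight_function \<omega> \<longleftrightarrow>
     (\<forall>t\<ge>0. 0 \<le> \<omega> t) \<and> continuous_on {0..} \<omega> \<and> mono_on {0..} \<omega> \<and>
     (\<exists>L\<ge>1. \<forall>t\<ge>0. \<omega> (2 * t) \<le> L * (\<omega> t + 1)) \<and>
     ln \<in> o[at_top](\<omega>) \<and>
     convex_on {0..} (\<lambda>t. \<omega> (exp t))"

definition weight_function :: "(real \<Rightarrow> real) \<Rightarrow> bool" where
  "weight_function \<omega> \<longleftrightarrow> general_weight_function \<omega> \<and> \<omega> \<in> O[at_top](\<lambda>t. t\<^sup>2)"

definition weight_le :: "(real \<Rightarrow> real) \<Rightarrow> (real \<Rightarrow> real) \<Rightarrow> bool" (infix \<open>\<preceq>\<^sub>w\<close> 50) where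
  "\<omega> \<preceq>\<^sub>w \<sigma> \<longleftrightarrow> \<sigma> \<in> O[at_top](\<omega>)"

text \<open>
  For a general weight function and \<open>s \<ge> 0\<close> the set below is bounded above, because
  \<open>t = ln (exp t) = o(\<omega> (exp t))\<close>, so that the real-valued supremum is the true one.
\<close>

definition young_conj :: "(real \<Rightarrow> real) \<Rightarrow> real \<Rightarrow> real" where
  "young_conj \<omega> s = (SUP t\<in>{0..}. t * s - \<omega> (exp t))"


section \<open>Multi-indices and smooth functions on \<open>\<real>\<^sup>d\<close>\<close>

text \<open>
  The dimension \<open>d\<close> has to be a quantifiable number, so \<open>\<real>\<^sup>d\<close> is the library's
  \<^const>\<open>Euclidean_space\<close>, i.e. the sequences of reals vanishing at all indices \<open>\<ge> d\<close>.
  Multi-indices are treated in the same way.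
\<close>

abbreviation Rd :: "nat \<Rightarrow> (nat \<Rightarrow> real) set" where
  "Rd d \<equiv> topspace (Euclidean_space d)"

definition multi_indices :: "nat \<Rightarrow> (nat \<Rightarrow> nat) set" where
  "multi_indices d = {\<alpha>. \<forall>i\<ge>d. \<alpha> i = 0}"

definition mabs :: "nat \<Rightarrow> (nat \<Rightarrow> nat) \<Rightarrow> nat" where
  "mabs d \<alpha> = (\<Sum>i<d. \<alpha> i)"

definition mpow :: "nat \<Rightarrow> (nat \<Rightarrow> real) \<Rightarrow> (nat \<Rightarrow> nat) \<Rightarrow> real" where
  "mpow d x \<alpha> = (\<Prod>i<d. x i ^ \<alpha> i)"

definition partial_deriv :: "nat \<Rightarrow> ((nat \<Rightarrow> real) \<Rightarrow> complex) \<Rightarrow> (nat \<Rightarrow> real) \<Rightarrow> complex" where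
  "partial_deriv i f x = vector_derivative (\<lambda>t. f (x(i := t))) (at (x i))"

text \<open>\<open>mderiv d \<beta> f\<close> is \<open>\<partial>\<^sub>0\<^bsup>\<beta> 0\<^esup> \<dots> \<partial>\<^sub>d\<^sub>-\<^sub>1\<^bsup>\<beta> (d-1)\<^esup> f\<close>.\<close>

definition mderiv ::
    "nat \<Rightarrow> (nat \<Rightarrow> nat) \<Rightarrow> ((nat \<Rightarrow> real) \<Rightarrow> complex) \<Rightarrow> (nat \<Rightarrow> real) \<Rightarrow> complex" where
  "mderiv d \<beta> f = foldr (\<lambda>i g. (partial_deriv i ^^ \<beta> i) g) [0..<d] f"

primrec Ck_on_Rd :: "nat \<Rightarrow> nat \<Rightarrow> ((nat \<Rightarrow> real) \<Rightarrow> complex) \<Rightarrow> bool" where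
  "Ck_on_Rd d 0 f \<longleftrightarrow> continuous_map (Euclidean_space d) euclidean f"
| "Ck_on_Rd d (Suc k) f \<longleftrightarrow>
     continuous_map (Euclidean_space d) euclidean f \<and>
     (\<forall>i<d. (\<forall>x\<in>Rd d. (\<lambda>t. f (x(i := t))) differentiable (at (x i))) \<and>
            Ck_on_Rd d k (partial_deriv i f))"

text \<open>
  A function on \<open>\<real>\<^sup>d\<close> is represented by its extension by \<open>0\<close> to all sequences, so that equality
  of representatives is equality on \<open>\<real>\<^sup>d\<close>. The partial derivatives in the directions \<open>i < d\<close> at
  points of \<open>\<real>\<^sup>d\<close> do not depend on the extension.
\<close>

definition smooth_Rd :: "nat \<Rightarrow> ((nat \<Rightarrow> real) \<Rightarrow> complex) set" where
  "smooth_Rd d = {f. (\<forall>x. x \<notin> Rd d \<longrightarrow> f x = 0) \<and> (\<forall>k. Ck_on_Rd d k f)}"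

definition sup_norm :: "nat \<Rightarrow> ((nat \<Rightarrow> real) \<Rightarrow> complex) \<Rightarrow> ennreal" where
  "sup_norm d f = (SUP x\<in>Rd d. ennreal (cmod (f x)))"


section \<open>Inductive limits of locally convex topologies\<close>

text \<open>
  \<open>lc_topology E T\<close>: \<open>T\<close> is a (not necessarily Hausdorff) locally convex vector space topology on
  the space \<open>E\<close> of complex-valued functions, with pointwise operations.
\<close>

definition lc_topology :: "('a \<Rightarrow> complex) set \<Rightarrow> ('a \<Rightarrow> complex) topology \<Rightarrow> bool" where
  "lc_topology E T \<longleftrightarrow>
     topspace T = E \<and>
     continuous_map (prod_topology T T) T (\<lambda>(f, g). \<lambda>x. f x + g x) \<and>
     continuous_map (prod_topology euclidean T) T (\<lambda>(c, f). \<lambda>x. c * f x) \<and>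
     (\<forall>U. openin T U \<and> (\<lambda>x. 0) \<in> U \<longrightarrow>
        (\<exists>V. openin T V \<and> (\<lambda>x. 0) \<in> V \<and> V \<subseteq> U \<and>
             (\<forall>f\<in>V. \<forall>g\<in>V. \<forall>t\<in>{0..1::real}.
                (\<lambda>x. complex_of_real (1 - t) * f x + complex_of_real t * g x) \<in> V)))"

text \<open>
  The locally convex inductive limit topology on \<open>E\<close> of spaces with topologies \<open>S i\<close> (\<open>i \<in> I\<close>)
  whose union is \<open>E\<close>: the finest locally convex topology on \<open>E\<close> for which all inclusions are
  continuous. It is obtained as the supremum of all such topologies, which is again one of them.
\<close>

definition inductive_limit_topology ::
    "('a \<Rightarrow> complex) set \<Rightarrow> 'i set \<Rightarrow> ('i \<Rightarrow> ('a \<Rightarrow> complex) topology) \<Rightarrow> ('a \<Rightarrow> complex) topology" where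
  "inductive_limit_topology E I S = topology_generated_by
     {U. \<exists>T. lc_topology E T \<and> (\<forall>i\<in>I. continuous_map (S i) T (\<lambda>f. f)) \<and> openin T U}"


section \<open>Gelfand--Shilov spaces of Roumieu type\<close>

definition weight_seq :: "(real \<Rightarrow> real) \<Rightarrow> nat \<Rightarrow> real \<Rightarrow> (nat \<Rightarrow> nat) \<Rightarrow> real" where
  "weight_seq \<omega> d \<mu> \<alpha> = exp (1 / \<mu> * young_conj \<omega> (\<mu> * real (mabs d \<alpha>)))"

datatype growth = Joint | Separated

fun weight_denom ::
    "growth \<Rightarrow> (real \<Rightarrow> real) \<Rightarrow> nat \<Rightarrow> real \<Rightarrow> (nat \<Rightarrow> nat) \<Rightarrow> (nat \<Rightarrow> nat) \<Rightarrow> real" where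
  "weight_denom Joint \<omega> d \<mu> \<alpha> \<beta> = weight_seq \<omega> d \<mu> (\<lambda>i. \<alpha> i + \<beta> i)"
| "weight_denom Separated \<omega> d \<mu> \<alpha> \<beta> = weight_seq \<omega> d \<mu> \<alpha> * weight_seq \<omega> d \<mu> \<beta>"

definition gs_norm ::
    "growth \<Rightarrow> (real \<Rightarrow> real) \<Rightarrow> nat \<Rightarrow> real \<Rightarrow> ((nat \<Rightarrow> real) \<Rightarrow> complex) \<Rightarrow> ennreal" where
  "gs_norm G \<omega> d \<mu> f =
     (SUP (\<alpha>, \<beta>) \<in> multi_indices d \<times> multi_indices d.
        sup_norm d (\<lambda>x. complex_of_real (mpow d x \<alpha>) * mderiv d \<beta> f x)
          / ennreal (weight_denom G \<omega> d \<mu> \<alpha> \<beta>))"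

definition gs_step ::
    "growth \<Rightarrow> (real \<Rightarrow> real) \<Rightarrow> nat \<Rightarrow> real \<Rightarrow> ((nat \<Rightarrow> real) \<Rightarrow> complex) set" where
  "gs_step G \<omega> d \<mu> = {f \<in> smooth_Rd d. gs_norm G \<omega> d \<mu> f < \<infinity>}"

definition gs_step_topology ::
    "growth \<Rightarrow> (real \<Rightarrow> real) \<Rightarrow> nat \<Rightarrow> real \<Rightarrow> ((nat \<Rightarrow> real) \<Rightarrow> complex) topology" where
  "gs_step_topology G \<omega> d \<mu> = topology (\<lambda>U. U \<subseteq> gs_step G \<omega> d \<mu> \<and>
     (\<forall>f\<in>U. \<exists>\<epsilon>>0. \<forall>g\<in>gs_step G \<omega> d \<mu>. gs_norm G \<omega> d \<mu> (\<lambda>x. g x - f x) < ennreal \<epsilon> \<longrightarrow> g \<in> U))"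

definition gs_space ::
    "growth \<Rightarrow> (real \<Rightarrow> real) \<Rightarrow> nat \<Rightarrow> ((nat \<Rightarrow> real) \<Rightarrow> complex) set" where
  "gs_space G \<omega> d = {f \<in> smooth_Rd d. \<exists>\<mu>>0. gs_norm G \<omega> d \<mu> f < \<infinity>}"

definition gs_topology ::
    "growth \<Rightarrow> (real \<Rightarrow> real) \<Rightarrow> nat \<Rightarrow> ((nat \<Rightarrow> real) \<Rightarrow> complex) topology" where
  "gs_topology G \<omega> d =
     inductive_limit_topology (gs_space G \<omega> d) {0<..} (gs_step_topology G \<omega> d)"

definition gs_continuous_inclusion ::
    "growth \<Rightarrow> (real \<Rightarrow> real) \<Rightarrow> (real \<Rightarrow> real) \<Rightarrow> nat \<Rightarrow> bool" where
  "gs_continuous_inclusion G \<omega> \<sigma> d \<longleftrightarrow>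
     gs_space G \<omega> d \<subseteq> gs_space G \<sigma> d \<and>
     continuous_map (gs_topology G \<omega> d) (gs_topology G \<sigma> d) (\<lambda>f. f)"

lemma openin_gs_step_topology:
  "openin (gs_step_topology G \<omega> d \<mu>) U \<longleftrightarrow> U \<subseteq> gs_step G \<omega> d \<mu> \<and>
     (\<forall>f\<in>U. \<exists>\<epsilon>>0. \<forall>g\<in>gs_step G \<omega> d \<mu>. gs_norm G \<omega> d \<mu> (\<lambda>x. g x - f x) < ennreal \<epsilon> \<longrightarrow> g \<in> U)"
proof -
  define near where "near \<epsilon> f g \<longleftrightarrow> gs_norm G \<omega> d \<mu> (\<lambda>x. g x - f x) < ennreal \<epsilon>" for \<epsilon> f g
  define S where "S = gs_step G \<omega> d \<mu>"
  define P where "P U \<longleftrightarrow> U \<subseteq> S \<and> (\<forall>f\<in>U. \<exists>\<epsilon>>0. \<forall>g\<in>S. near \<epsilon> f g \<longrightarrow> g \<in> U)" for U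
  have near_mono: "near b f g" if "near a f g" "a \<le> b" for a b f g
    using that unfolding near_def by (meson ennreal_leI order.strict_trans2)
  have "P (U \<inter> V)" if U: "P U" and V: "P V" for U V
    unfolding P_def
  proof (intro conjI ballI)
    show "U \<inter> V \<subseteq> S" using U by (auto simp: P_def)
    fix f assume f: "f \<in> U \<inter> V"
    obtain a where a: "a > 0" "\<forall>g\<in>S. near a f g \<longrightarrow> g \<in> U"
      using U f unfolding P_def by blast
    obtain b where b: "b > 0" "\<forall>g\<in>S. near b f g \<longrightarrow> g \<in> V"
      using V f unfolding P_def by blast
    have "\<forall>g\<in>S. near (min a b) f g \<longrightarrow> g \<in> U \<inter> V"
      using a(2) b(2) near_mono[of "min a b" f _ a] near_mono[of "min a b" f _ b] by simp
    then show "\<exists>\<epsilon>>0. \<forall>g\<in>S. near \<epsilon> f g \<longrightarrow> g \<in> U \<inter> V"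
      using a(1) b(1) by (intro exI[of _ "min a b"]) simp
  qed
  moreover have "P (\<Union>\<K>)" if K: "\<forall>K\<in>\<K>. P K" for \<K>
    unfolding P_def
  proof (intro conjI ballI)
    show "\<Union>\<K> \<subseteq> S" using K by (auto simp: P_def)
    fix f assume "f \<in> \<Union>\<K>"
    then obtain K' where K': "K' \<in> \<K>" "f \<in> K'" by blast
    then obtain a where "a > 0" "\<forall>g\<in>S. near a f g \<longrightarrow> g \<in> K'"
      using K unfolding P_def by blast
    then show "\<exists>\<epsilon>>0. \<forall>g\<in>S. near \<epsilon> f g \<longrightarrow> g \<in> \<Union>\<K>"
      using K'(1) by blast
  qed
  ultimately have "istopology P"
    by (simp add: istopology_def)
  then have "openin (topology P) U = P U"
    by (simp add: topology_inverse')
  then show ?thesis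
    by (simp add: P_def[abs_def] S_def near_def gs_step_topology_def)
qed

end

theory Submission
  imports Defs "HOL-Complex_Analysis.Cauchy_Integral_Formula"
begin

text \<open>
  Everything rests on one description of the weight sequences: substituting \<open>x = e\<^sup>t\<close> in the
  Young conjugate gives, for \<open>|\<alpha>| = n\<close>,
  \<open>W\<^sub>\<alpha> = sup {x^n * exp (- \<omega> x / \<mu>) | x \<ge> 1}\<close>.
  So a larger weight has smaller sequences, and the sequence remembers the weight up to the
  parameter \<open>\<mu>\<close> (convexity of \<open>\<omega> \<circ> exp\<close>).

  \<^emph>\<open>Sufficiency.\<close> If \<open>\<sigma> \<le> C (\<omega> + 1)\<close>, the formula gives
  \<open>W\<^sub>\<omega>\<^sup>(\<^sup>\<mu>\<^sup>) \<le> exp (1 / \<mu>) W\<^sub>\<sigma>\<^sup>(\<^sup>C\<^sup>\<mu>\<^sup>)\<close>, hence each step of the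
  first inductive system embeds continuously into a step of the second
  (\<open>gs_norm_compare\<close>). Restricting a locally convex topology of the larger space to the smaller
  one yields a competitor in the definition of the inductive limit topology there, and this is
  continuity of the inclusion (\<open>continuous_map_inductive_limit\<close>).

  \<^emph>\<open>Necessity.\<close> It is enough to find one function in the space of \<open>\<omega>\<close> that decays no faster
  than \<open>\<omega>\<close> permits. The function is
  \<open>F(z) = \<Sum>j. exp (- 2 \<omega>(2\<^sup>j)) exp (- (z - 2\<^sup>j)\<^sup>2)\<close>, a sum of Gaussian bumps
  whose heights follow the weight along the powers of two. It is entire, and Cauchy's inequality
  on a circle of radius \<open>\<surd>n\<close> bounds its \<open>n\<close>-th derivative by \<open>e^n * sqrt (n!)\<close> times a
  similar sum. Since \<open>\<omega>(t) = O(t\<^sup>2)\<close>, the numbers \<open>sqrt (n!)\<close> are dominated by a weight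
  sequence of \<open>\<omega>\<close>, and powers of \<open>x\<close> cost only the factor \<open>(2\<^sup>j)^m exp (- \<omega>(2\<^sup>j))\<close> and another
  \<open>sqrt (m!)\<close>; geometric factors are absorbed by the doubling condition
  (\<open>dyadic_gauss_sum_in_gs_space\<close>). On the other hand \<open>F(2\<^sup>j) \<ge> exp (- 2 \<omega>(2\<^sup>j))\<close>,
  while membership in the space of \<open>\<sigma>\<close> forces decay like \<open>x exp (- \<sigma>(x) / \<mu>)\<close>. Comparing
  the two gives \<open>\<sigma> = O(\<omega>)\<close> at powers of two, and by doubling everywhere.
\<close>

section \<open>Weight sequences as suprema over the half-line\<close>

definition conj_weight :: "(real \<Rightarrow> real) \<Rightarrow> real \<Rightarrow> nat \<Rightarrow> real" where
  "conj_weight \<omega> \<mu> n = exp (1 / \<mu> * young_conj \<omega> (\<mu> * real n))"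

lemma conj_weight_pos: "conj_weight \<omega> \<mu> n > 0"
  by (simp add: conj_weight_def)

lemma general_weight_functionD:
  assumes "general_weight_function \<omega>"
  shows general_weight_nonneg: "\<And>t. t \<ge> 0 \<Longrightarrow> \<omega> t \<ge> 0"
    and general_weight_mono: "\<And>s t. 0 \<le> s \<Longrightarrow> s \<le> t \<Longrightarrow> \<omega> s \<le> \<omega> t"
    and general_weight_convex: "convex_on {0..} (\<lambda>t. \<omega> (exp t))"
    and general_weight_log: "ln \<in> o[at_top](\<omega>)"
  using assms by (auto simp: general_weight_function_def mono_on_def)

lemma general_weight_doubling:
  assumes "general_weight_function \<omega>"
  obtains L where "L \<ge> 1" "\<And>t. t \<ge> 0 \<Longrightarrow> \<omega> (2 * t) \<le> L * (\<omega> t + 1)"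
  using assms by (auto simp: general_weight_function_def)

lemma weight_dominates_log:
  assumes \<omega>: "general_weight_function \<omega>" and c: "c > 0"
  obtains T where "T \<ge> 1" "\<And>x. x \<ge> T \<Longrightarrow> ln x \<le> c * \<omega> x"
proof -
  have "\<forall>\<^sub>F x in at_top. norm (ln x) \<le> c * norm (\<omega> x)"
    using landau_o.smallD[OF general_weight_log[OF \<omega>] c] .
  then obtain T where T: "\<And>x. x \<ge> T \<Longrightarrow> norm (ln x) \<le> c * norm (\<omega> x)"
    by (auto simp: eventually_at_top_linorder)
  have "ln x \<le> c * \<omega> x" if "x \<ge> max T 1" for x
    using T[of x] that general_weight_nonneg[OF \<omega>, of x] by auto
  then show ?thesis
    by (intro that[of "max T 1"]) auto
qed

text \<open>
  By \<open>(\<gamma>)\<close>, \<open>t (|s| + 1) \<le> \<omega> (e\<^sup>t)\<close> for all large \<open>t\<close>, so only a bounded range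
  of \<open>t\<close> contributes positive values. Without this the real-valued supremum would be meaningless.
\<close>

lemma young_conj_bdd_above:
  assumes \<omega>: "general_weight_function \<omega>"
  shows "bdd_above ((\<lambda>t. t * s - \<omega> (exp t)) ` {0..})"
proof -
  obtain T where T: "T \<ge> 1" "\<And>x. x \<ge> T \<Longrightarrow> ln x \<le> 1 / (\<bar>s\<bar> + 1) * \<omega> x"
    using weight_dominates_log[OF \<omega>, of "1 / (\<bar>s\<bar> + 1)"]
    by (metis abs_ge_zero add_nonneg_pos zero_less_divide_1_iff zero_less_one)
  have "t * s - \<omega> (exp t) \<le> ln T * \<bar>s\<bar>" if t: "t \<ge> 0" for t
  proof (cases "exp t \<ge> T")
    case True
    then have "t \<le> 1 / (\<bar>s\<bar> + 1) * \<omega> (exp t)"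
      using T(2)[of "exp t"] by simp
    then have "t * (\<bar>s\<bar> + 1) \<le> \<omega> (exp t)"
      by (simp add: field_simps)
    moreover have "t * s \<le> t * (\<bar>s\<bar> + 1)"
      using t by (intro mult_left_mono) auto
    moreover have "0 \<le> ln T * \<bar>s\<bar>"
      using T(1) by simp
    ultimately show ?thesis by linarith
  next
    case False
    then have "t \<le> ln T"
      using T(1) by (metis less_eq_real_def linorder_not_le ln_exp ln_mono exp_gt_zero)
    then have "t * \<bar>s\<bar> \<le> ln T * \<bar>s\<bar>"
      by (simp add: mult_right_mono)
    moreover have "t * s \<le> t * \<bar>s\<bar>"
      using t by (simp add: mult_left_mono)
    moreover have "\<omega> (exp t) \<ge> 0"
      using general_weight_nonneg[OF \<omega>] by simp
    ultimately show ?thesis by linarith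
  qed
  then show ?thesis
    by (intro bdd_aboveI2[where M = "ln T * \<bar>s\<bar>"]) auto
qed

text \<open>
  This lemma and the next one together say that \<open>conj_weight \<omega> \<mu> n\<close> is the supremum of
  \<open>x^n * exp (- \<omega> x / \<mu>)\<close> over \<open>x \<ge> 1\<close>. The Young conjugate does not occur after them.
\<close>

lemma conj_weight_upper:
  assumes \<omega>: "general_weight_function \<omega>" and "\<mu> > 0" "x \<ge> 1"
  shows "x ^ n * exp (- \<omega> x / \<mu>) \<le> conj_weight \<omega> \<mu> n"
proof -
  have "ln x * (\<mu> * n) - \<omega> (exp (ln x)) \<le> young_conj \<omega> (\<mu> * n)"
    unfolding young_conj_def using assms
    by (intro cSUP_upper young_conj_bdd_above) auto
  then have "(ln x * (\<mu> * n) - \<omega> x) / \<mu> \<le> young_conj \<omega> (\<mu> * n) / \<mu>"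
    using assms by (intro divide_right_mono) auto
  then have "n * ln x - \<omega> x / \<mu> \<le> 1 / \<mu> * young_conj \<omega> (\<mu> * n)"
    using assms by (simp add: diff_divide_distrib mult_ac)
  then have "exp (n * ln x - \<omega> x / \<mu>) \<le> conj_weight \<omega> \<mu> n"
    by (simp add: conj_weight_def)
  moreover have "exp (n * ln x - \<omega> x / \<mu>) = x ^ n * exp (- \<omega> x / \<mu>)"
    using assms by (simp add: exp_diff exp_minus exp_of_nat_mult divide_inverse)
  ultimately show ?thesis by simp
qed

lemma conj_weight_least:
  assumes \<mu>: "\<mu> > 0" and B: "\<And>x. x \<ge> 1 \<Longrightarrow> x ^ n * exp (- \<omega> x / \<mu>) \<le> B"
  shows "conj_weight \<omega> \<mu> n \<le> B"
proof -
  have "0 < exp (- \<omega> 1 / \<mu>)" by simp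
  also have "\<dots> \<le> B" using B[of 1] by simp
  finally have "B > 0" .
  have "t * (\<mu> * n) - \<omega> (exp t) \<le> \<mu> * ln B" if "t \<ge> 0" for t
  proof -
    have "exp (n * t - \<omega> (exp t) / \<mu>) = exp t ^ n * exp (- \<omega> (exp t) / \<mu>)"
      by (simp add: exp_diff exp_minus divide_inverse exp_of_nat_mult)
    also have "\<dots> \<le> B"
      using B[of "exp t"] that by simp
    finally have "n * t - \<omega> (exp t) / \<mu> \<le> ln B"
      using ln_ge_iff[OF \<open>B > 0\<close>] by blast
    then have "\<mu> * (n * t - \<omega> (exp t) / \<mu>) \<le> \<mu> * ln B"
      using \<mu> by (intro mult_left_mono) auto
    then show ?thesis
      using \<mu> by (simp add: right_diff_distrib mult_ac)
  qed
  then have "young_conj \<omega> (\<mu> * n) \<le> \<mu> * ln B"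
    unfolding young_conj_def by (intro cSUP_least) auto
  then have "1 / \<mu> * young_conj \<omega> (\<mu> * n) \<le> ln B"
    using \<mu> by (simp add: pos_divide_le_eq mult_ac)
  then show ?thesis
    unfolding conj_weight_def using ln_ge_iff[OF \<open>B > 0\<close>] by blast
qed

lemma conj_weight_mono:
  assumes \<omega>: "general_weight_function \<omega>" and "0 < \<mu>" "\<mu> \<le> \<nu>"
  shows "conj_weight \<omega> \<mu> n \<le> conj_weight \<omega> \<nu> n"
proof (rule conj_weight_least[OF \<open>0 < \<mu>\<close>])
  fix x :: real assume x: "x \<ge> 1"
  have "\<omega> x / \<nu> \<le> \<omega> x / \<mu>"
    using assms x general_weight_nonneg[OF \<omega>, of x] by (intro divide_left_mono) auto
  then have "x ^ n * exp (- \<omega> x / \<mu>) \<le> x ^ n * exp (- \<omega> x / \<nu>)"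
    using x by (intro mult_left_mono) auto
  also have "\<dots> \<le> conj_weight \<omega> \<nu> n"
    using assms x by (intro conj_weight_upper) auto
  finally show "x ^ n * exp (- \<omega> x / \<mu>) \<le> conj_weight \<omega> \<nu> n" .
qed

text \<open>
  The hypothesis gives \<open>\<omega> x / \<mu> \<ge> \<sigma> x / (C \<mu>) - 1 / \<mu>\<close>; the constant \<open>exp (1 / \<mu>)\<close> pays
  for the additive one.
\<close>

lemma conj_weight_compare:
  assumes \<sigma>: "general_weight_function \<sigma>" and \<mu>: "\<mu> > 0" and C: "C > 0"
    and le: "\<And>x. x \<ge> 1 \<Longrightarrow> \<sigma> x \<le> C * (\<omega> x + 1)"
  shows "conj_weight \<omega> \<mu> n \<le> exp (1 / \<mu>) * conj_weight \<sigma> (C * \<mu>) n"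
proof (rule conj_weight_least[OF \<mu>])
  fix x :: real assume x: "x \<ge> 1"
  have "\<sigma> x / (C * \<mu>) \<le> C * (\<omega> x + 1) / (C * \<mu>)"
    using le[OF x] \<mu> C by (intro divide_right_mono) auto
  also have "\<dots> = \<omega> x / \<mu> + 1 / \<mu>"
    using C by (simp add: add_divide_distrib)
  finally have "- \<omega> x / \<mu> \<le> 1 / \<mu> + - \<sigma> x / (C * \<mu>)"
    by simp
  then have "exp (- \<omega> x / \<mu>) \<le> exp (1 / \<mu>) * exp (- \<sigma> x / (C * \<mu>))"
    by (simp only: exp_add[symmetric] exp_le_cancel_iff)
  then have "x ^ n * exp (- \<omega> x / \<mu>) \<le> x ^ n * (exp (1 / \<mu>) * exp (- \<sigma> x / (C * \<mu>)))"
    using x by (intro mult_left_mono) auto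
  also have "\<dots> = exp (1 / \<mu>) * (x ^ n * exp (- \<sigma> x / (C * \<mu>)))"
    by (simp only: mult_ac)
  also have "\<dots> \<le> exp (1 / \<mu>) * conj_weight \<sigma> (C * \<mu>) n"
    using x \<sigma> \<mu> C by (intro mult_left_mono conj_weight_upper) auto
  finally show "x ^ n * exp (- \<omega> x / \<mu>) \<le> exp (1 / \<mu>) * conj_weight \<sigma> (C * \<mu>) n" .
qed

text \<open>
  In a product of two terms of the suprema both points may be replaced by the larger one:
  the powers grow, and of the two nonnegative weights one is dropped. This is what makes
  separated growth at least as strong as joint growth.
\<close>

lemma conj_weight_mult_le:
  assumes \<omega>: "general_weight_function \<omega>" and \<mu>: "\<mu> > 0"
  shows "conj_weight \<omega> \<mu> m * conj_weight \<omega> \<mu> n \<le> conj_weight \<omega> \<mu> (m + n)"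
proof -
  let ?W = "conj_weight \<omega> \<mu>"
  have prod: "(x ^ m * exp (- \<omega> x / \<mu>)) * (y ^ n * exp (- \<omega> y / \<mu>)) \<le> ?W (m + n)"
    if x: "x \<ge> 1" and y: "y \<ge> 1" for x y
  proof -
    define z where "z = max x y"
    have "\<omega> z \<le> \<omega> x + \<omega> y"
      using x y general_weight_nonneg[OF \<omega>, of x] general_weight_nonneg[OF \<omega>, of y]
      by (auto simp: z_def max_def)
    then have "\<omega> z / \<mu> \<le> \<omega> x / \<mu> + \<omega> y / \<mu>"
      using \<mu> by (simp flip: add_divide_distrib add: divide_right_mono)
    then have "- \<omega> x / \<mu> + - \<omega> y / \<mu> \<le> - \<omega> z / \<mu>"
      by simp
    then have 1: "exp (- \<omega> x / \<mu>) * exp (- \<omega> y / \<mu>) \<le> exp (- \<omega> z / \<mu>)"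
      by (simp only: exp_add[symmetric] exp_le_cancel_iff)
    have 2: "x ^ m * y ^ n \<le> z ^ m * z ^ n"
      using x y by (intro mult_mono power_mono) (auto simp: z_def)
    have "(x ^ m * y ^ n) * (exp (- \<omega> x / \<mu>) * exp (- \<omega> y / \<mu>))
        \<le> (z ^ m * z ^ n) * exp (- \<omega> z / \<mu>)"
      using x by (intro mult_mono[OF 2 1]) (auto simp: z_def)
    also have "\<dots> \<le> ?W (m + n)"
      using conj_weight_upper[OF \<omega> \<mu>, of z "m + n"] x by (simp add: power_add z_def)
    finally show ?thesis by (simp add: mult_ac)
  qed
  have "?W m \<le> ?W (m + n) / ?W n"
  proof (rule conj_weight_least[OF \<mu>])
    fix x :: real assume x: "x \<ge> 1"
    let ?a = "x ^ m * exp (- \<omega> x / \<mu>)"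
    have a: "?a > 0" using x by simp
    have "?W n \<le> ?W (m + n) / ?a"
      using prod[OF x] a by (intro conj_weight_least[OF \<mu>]) (simp add: pos_le_divide_eq mult_ac)
    then show "?a \<le> ?W (m + n) / ?W n"
      using a conj_weight_pos[of \<omega> \<mu> n] by (simp add: pos_le_divide_eq mult_ac)
  qed
  then show ?thesis
    using conj_weight_pos[of \<omega> \<mu> n] by (simp add: pos_le_divide_eq)
qed

lemma weight_iterated_doubling:
  assumes \<omega>: "general_weight_function \<omega>"
  shows "\<exists>K\<ge>1. \<forall>t\<ge>0. \<omega> (2 ^ k * t) \<le> K * (\<omega> t + 1)"
proof (induction k)
  case 0
  then show ?case by (intro exI[of _ 1]) auto
next
  case (Suc k)
  then obtain K where K: "K \<ge> 1" "\<And>t. t \<ge> 0 \<Longrightarrow> \<omega> (2 ^ k * t) \<le> K * (\<omega> t + 1)" by blast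
  obtain L where L: "L \<ge> 1" "\<And>t. t \<ge> 0 \<Longrightarrow> \<omega> (2 * t) \<le> L * (\<omega> t + 1)"
    using general_weight_doubling[OF \<omega>] by blast
  have "\<omega> (2 ^ Suc k * t) \<le> (K * (L + 1)) * (\<omega> t + 1)" if t: "t \<ge> 0" for t
  proof -
    have "\<omega> (2 ^ Suc k * t) \<le> K * (\<omega> (2 * t) + 1)"
      using K(2)[of "2 * t"] t by (simp add: mult_ac)
    also have "\<dots> \<le> K * ((L + 1) * (\<omega> t + 1))"
      using K(1) L(2)[OF t] general_weight_nonneg[OF \<omega> t]
      by (intro mult_left_mono) (auto simp: algebra_simps)
    finally show ?thesis by (simp add: mult_ac)
  qed
  moreover have "K * (L + 1) \<ge> 1"
    using K(1) L(1) mult_mono[of 1 K 1 "L + 1"] by simp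
  ultimately show ?case by blast
qed

text \<open>
  Geometric factors are harmless: after rounding \<open>|A|\<close> up to \<open>2\<^sup>k\<close>, the factor
  \<open>(2\<^sup>k)^n\<close> turns \<open>x^n\<close> into \<open>(2\<^sup>k x)^n\<close>, and iterated doubling bounds \<open>\<omega> (2\<^sup>k x)\<close> by a multiple
  of \<open>\<omega> x + 1\<close>, which only enlarges the parameter.
\<close>

lemma conj_weight_geometric:
  assumes \<omega>: "general_weight_function \<omega>" and \<mu>: "\<mu> > 0"
  shows "\<exists>\<nu>>0. \<exists>C. \<forall>n. A ^ n * conj_weight \<omega> \<mu> n \<le> C * conj_weight \<omega> \<nu> n"
proof -
  obtain k where k: "\<bar>A\<bar> < 2 ^ k"
    using real_arch_pow[of 2 "\<bar>A\<bar>"] by auto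
  obtain K where K: "K \<ge> 1" "\<And>t. t \<ge> 0 \<Longrightarrow> \<omega> (2 ^ k * t) \<le> K * (\<omega> t + 1)"
    using weight_iterated_doubling[OF \<omega>] by blast
  have "A ^ n * conj_weight \<omega> \<mu> n \<le> exp (1 / \<mu>) * conj_weight \<omega> (K * \<mu>) n" for n
  proof -
    have "conj_weight \<omega> \<mu> n \<le> exp (1 / \<mu>) * conj_weight \<omega> (K * \<mu>) n / (2 ^ k) ^ n"
    proof (rule conj_weight_least[OF \<mu>])
      fix x :: real assume x: "x \<ge> 1"
      have "1 * 1 \<le> 2 ^ k * x"
        using x by (intro mult_mono) auto
      then have x': "2 ^ k * x \<ge> 1" by simp
      have "\<omega> (2 ^ k * x) / (K * \<mu>) \<le> K * (\<omega> x + 1) / (K * \<mu>)"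
        using K(1) K(2)[of x] x \<mu> by (intro divide_right_mono) auto
      also have "\<dots> = \<omega> x / \<mu> + 1 / \<mu>"
        using K(1) by (simp add: add_divide_distrib)
      finally have "- \<omega> x / \<mu> \<le> 1 / \<mu> + - \<omega> (2 ^ k * x) / (K * \<mu>)"
        by simp
      then have "exp (- \<omega> x / \<mu>) \<le> exp (1 / \<mu>) * exp (- \<omega> (2 ^ k * x) / (K * \<mu>))"
        by (simp only: exp_add[symmetric] exp_le_cancel_iff)
      then have "(2 ^ k * x) ^ n * exp (- \<omega> x / \<mu>)
          \<le> (2 ^ k * x) ^ n * (exp (1 / \<mu>) * exp (- \<omega> (2 ^ k * x) / (K * \<mu>)))"
        using x by (intro mult_left_mono) auto
      also have "\<dots> = exp (1 / \<mu>) * ((2 ^ k * x) ^ n * exp (- \<omega> (2 ^ k * x) / (K * \<mu>)))"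
        by (simp only: mult_ac)
      also have "\<dots> \<le> exp (1 / \<mu>) * conj_weight \<omega> (K * \<mu>) n"
        using x' \<mu> K(1) by (intro mult_left_mono conj_weight_upper[OF \<omega>]) auto
      finally have "(x ^ n * exp (- \<omega> x / \<mu>)) * (2 ^ k) ^ n \<le> exp (1 / \<mu>) * conj_weight \<omega> (K * \<mu>) n"
        by (simp only: power_mult_distrib mult_ac)
      then show "x ^ n * exp (- \<omega> x / \<mu>) \<le> exp (1 / \<mu>) * conj_weight \<omega> (K * \<mu>) n / (2 ^ k) ^ n"
        by (subst pos_le_divide_eq) auto
    qed
    then have "(2 ^ k) ^ n * conj_weight \<omega> \<mu> n \<le> exp (1 / \<mu>) * conj_weight \<omega> (K * \<mu>) n"
      by (subst (asm) pos_le_divide_eq) (auto simp: mult_ac)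
    moreover have "A ^ n \<le> (2 ^ k) ^ n"
      using k by (metis abs_ge_self abs_ge_zero less_eq_real_def order_trans power_abs power_mono)
    ultimately show ?thesis
      using conj_weight_pos[of \<omega> \<mu> n] mult_right_mono[of "A ^ n" "(2 ^ k) ^ n" "conj_weight \<omega> \<mu> n"]
      by linarith
  qed
  then show ?thesis
    using K(1) \<mu> by (intro exI[of _ "K * \<mu>"]) auto
qed

text \<open>
  The only place where \<open>(\<beta>)\<close> enters. With \<open>\<omega> x \<le> B + c x\<^sup>2\<close>, the choice \<open>x = \<surd>n\<close> in
  the supremum gives at least \<open>n^(n/2) * exp (- B - c n)\<close>, and \<open>n! \<le> n^n\<close>.
\<close>

lemma sqrt_fact_le_conj_weight:
  assumes \<omega>: "weight_function \<omega>"
  shows "\<exists>\<mu>>0. \<exists>C. \<forall>n. sqrt (fact n) \<le> C * conj_weight \<omega> \<mu> n"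
proof -
  have gen: "general_weight_function \<omega>"
    using \<omega> by (simp add: weight_function_def)
  have "\<omega> \<in> O[at_top](\<lambda>t. t\<^sup>2)"
    using \<omega> by (simp add: weight_function_def)
  then obtain c where "c > 0" "\<forall>\<^sub>F x in at_top. norm (\<omega> x) \<le> c * norm (x\<^sup>2)"
    by (elim landau_o.bigE)
  then obtain T where T: "\<And>x. x \<ge> T \<Longrightarrow> \<bar>\<omega> x\<bar> \<le> c * x\<^sup>2"
    by (auto simp: eventually_at_top_linorder)
  define B where "B = \<omega> (max T 1)"
  have B: "\<omega> x \<le> B + c * x\<^sup>2" if "x \<ge> 1" for x
  proof (cases "x \<ge> T")
    case True
    have "B \<ge> 0" by (simp add: B_def general_weight_nonneg[OF gen])
    with T[OF True] show ?thesis by linarith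
  next
    case False
    then have "\<omega> x \<le> B"
      unfolding B_def using that by (intro general_weight_mono[OF gen]) auto
    moreover have "0 \<le> c * x\<^sup>2" using \<open>c > 0\<close> by simp
    ultimately show ?thesis by linarith
  qed
  have "sqrt (fact n) \<le> exp B * (exp c ^ n * conj_weight \<omega> 1 n)" for n
  proof (cases "n = 0")
    case True
    have "exp (- \<omega> 1) \<le> conj_weight \<omega> 1 0"
      using conj_weight_upper[OF gen, of 1 1 0] by simp
    moreover have "\<omega> 1 \<le> B"
      unfolding B_def by (intro general_weight_mono[OF gen]) auto
    then have "1 \<le> exp B * exp (- \<omega> 1)"
      by (simp add: mult_exp_exp)
    ultimately have "1 \<le> exp B * conj_weight \<omega> 1 0"
      by (meson exp_ge_zero mult_left_mono order_trans)
    then show ?thesis using True by simp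
  next
    case False
    define x where "x = sqrt n"
    have x: "x \<ge> 1" "x\<^sup>2 = n" using False by (auto simp: x_def)
    have "(fact n :: real) \<le> n ^ n"
      using fact_le_power[of n] by simp
    then have "sqrt (fact n) \<le> sqrt (n ^ n)" by simp
    also have "\<dots> = x ^ n" by (simp add: x_def real_sqrt_power)
    also have "\<dots> = exp B * exp c ^ n * (x ^ n * exp (- (B + c * x\<^sup>2)))"
    proof -
      have "exp B * exp c ^ n * exp (- (B + c * x\<^sup>2)) = exp (B + n * c + - (B + c * x\<^sup>2))"
        by (simp only: exp_add exp_of_nat_mult)
      also have "B + n * c + - (B + c * x\<^sup>2) = 0"
        by (simp add: x)
      finally have "exp B * exp c ^ n * exp (- (B + c * x\<^sup>2)) = 1" by simp
      then show ?thesis by (metis mult.left_commute mult.right_neutral)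
    qed
    also have "\<dots> \<le> exp B * exp c ^ n * (x ^ n * exp (- \<omega> x / 1))"
      using B[of x] x by (intro mult_left_mono) auto
    also have "\<dots> \<le> exp B * exp c ^ n * conj_weight \<omega> 1 n"
      using x by (intro mult_left_mono conj_weight_upper[OF gen]) auto
    finally show ?thesis by (simp add: mult_ac)
  qed
  moreover obtain \<nu> C where "\<nu> > 0" "\<And>n. exp c ^ n * conj_weight \<omega> 1 n \<le> C * conj_weight \<omega> \<nu> n"
    using conj_weight_geometric[OF gen, of 1 "exp c"] by auto
  ultimately have "\<forall>n. sqrt (fact n) \<le> (exp B * C) * conj_weight \<omega> \<nu> n"
    by (metis exp_ge_zero mult.assoc mult_left_mono order_trans)
  with \<open>\<nu> > 0\<close> show ?thesis by blast
qed

text \<open>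
  The nontrivial half of the biconjugate theorem, with integer exponents. Let \<open>s\<close> be a
  subgradient of \<open>\<phi> t = \<sigma> (e\<^sup>t)\<close> at \<open>ln x\<close>; then \<open>y^(s/\<mu>) * exp (- \<sigma> y / \<mu>)\<close> is maximal at
  \<open>y = x\<close>. Rounding the exponent \<open>s / \<mu>\<close> down to an integer costs at most one factor \<open>x\<close>.
\<close>

lemma conj_weight_biconjugate:
  assumes \<sigma>: "general_weight_function \<sigma>" and \<mu>: "\<mu> > 0" and x: "x > 1"
  shows "\<exists>n. conj_weight \<sigma> \<mu> n * exp (\<sigma> x / \<mu>) \<le> x ^ Suc n"
proof -
  define \<phi> where "\<phi> t = \<sigma> (exp t)" for t
  define s where "s = Inf ((\<lambda>t. (\<phi> (ln x) - \<phi> t) / (ln x - t)) ` ({ln x<..} \<inter> {0..}))"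
  have cvx: "convex_on {0..} \<phi>"
    using general_weight_convex[OF \<sigma>] by (simp add: \<phi>_def[abs_def])
  have subgrad: "\<phi> u \<ge> \<phi> (ln x) + s * (u - ln x)" if "u \<ge> 0" for u
    unfolding s_def
    using that x by (intro convex_le_Inf_differential[OF cvx]) auto
  \<comment> \<open>A negative slope at \<open>ln x > 0\<close> would make \<open>\<phi>\<close> decrease.\<close>
  have "s \<ge> 0"
  proof (rule ccontr)
    assume "\<not> s \<ge> 0"
    then have "s * (0 - ln x) > 0"
      using x by (simp add: mult_less_0_iff)
    moreover have "\<phi> 0 \<le> \<phi> (ln x)"
      using x unfolding \<phi>_def by (intro general_weight_mono[OF \<sigma>]) auto
    ultimately show False
      using subgrad[of 0] by simp
  qed
  \<comment> \<open>Rounding down keeps \<open>y^(n - s/\<mu>) \<le> 1\<close> for all \<open>y \<ge> 1\<close>.\<close>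
  define n where "n = nat \<lfloor>s / \<mu>\<rfloor>"
  have n: "n \<le> s / \<mu>" "s / \<mu> \<le> n + 1"
    using \<open>s \<ge> 0\<close> \<mu> by (auto simp: n_def of_nat_nat) linarith
  have "conj_weight \<sigma> \<mu> n \<le> x ^ Suc n / exp (\<sigma> x / \<mu>)"
  proof (rule conj_weight_least[OF \<mu>])
    fix y :: real assume y: "y \<ge> 1"
    have "\<sigma> x + s * (ln y - ln x) \<le> \<sigma> y"
      using subgrad[of "ln y"] x y by (simp add: \<phi>_def)
    then have "(\<sigma> x + s * (ln y - ln x)) / \<mu> \<le> \<sigma> y / \<mu>"
      using \<mu> by (intro divide_right_mono) auto
    then have "\<sigma> x / \<mu> + s / \<mu> * (ln y - ln x) \<le> \<sigma> y / \<mu>"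
      by (simp add: add_divide_distrib)
    moreover have "n * ln y \<le> s / \<mu> * ln y"
      using n(1) y by (intro mult_right_mono) auto
    moreover have "s / \<mu> * ln x \<le> (n + 1) * ln x"
      using n(2) x by (intro mult_right_mono) auto
    ultimately have "n * ln y + - \<sigma> y / \<mu> \<le> (n + 1) * ln x - \<sigma> x / \<mu>"
      by (simp add: algebra_simps)
    then have "exp (n * ln y + - \<sigma> y / \<mu>) \<le> exp (Suc n * ln x - \<sigma> x / \<mu>)"
      by simp
    then show "y ^ n * exp (- \<sigma> y / \<mu>) \<le> x ^ Suc n / exp (\<sigma> x / \<mu>)"
      using x y by (simp only: exp_add exp_diff exp_of_nat_mult exp_ln)
  qed
  then have "conj_weight \<sigma> \<mu> n * exp (\<sigma> x / \<mu>) \<le> x ^ Suc n"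
    by (simp only: pos_le_divide_eq exp_gt_zero)
  then show ?thesis ..
qed

section \<open>Linear combinations of smooth functions\<close>

lemma Rd_update: "x \<in> Rd d \<Longrightarrow> i < d \<Longrightarrow> x(i := t) \<in> Rd d"
  by (auto simp: topspace_Euclidean_space)

text \<open>
  Derivatives at points of \<open>\<real>\<^sup>d\<close> in the first \<open>d\<close> directions only see values on \<open>\<real>\<^sup>d\<close>. The
  congruence lemmas are needed because differentiated functions are only known there.
\<close>

lemma partial_deriv_cong_Rd:
  assumes "\<And>y. y \<in> Rd d \<Longrightarrow> f y = g y" "i < d" "x \<in> Rd d"
  shows "partial_deriv i f x = partial_deriv i g x"
  unfolding partial_deriv_def using assms by (simp add: Rd_update cong: if_cong)

lemma Ck_on_Rd_cong:
  assumes "\<And>y. y \<in> Rd d \<Longrightarrow> f y = g y" "Ck_on_Rd d k f"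
  shows "Ck_on_Rd d k g"
  using assms
proof (induction k arbitrary: f g)
  case 0
  then show ?case by (auto intro: continuous_map_eq)
next
  case (Suc k)
  have "(\<lambda>t. g (x(i := t))) = (\<lambda>t. f (x(i := t)))" if "i < d" "x \<in> Rd d" for i x
    using Suc.prems(1) Rd_update[OF that(2,1)] by (intro ext) metis
  then have "(\<lambda>t. g (x(i := t))) differentiable (at (x i))" if "i < d" "x \<in> Rd d" for i x
    using Suc.prems(2) that by simp
  moreover have "Ck_on_Rd d k (partial_deriv i g)" if "i < d" for i
  proof (rule Suc.IH)
    show "partial_deriv i f y = partial_deriv i g y" if "y \<in> Rd d" for y
      using Suc.prems(1) \<open>i < d\<close> that by (rule partial_deriv_cong_Rd)
    show "Ck_on_Rd d k (partial_deriv i f)"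
      using Suc.prems(2) \<open>i < d\<close> by simp
  qed
  moreover have "continuous_map (Euclidean_space d) euclidean g"
    using Suc.prems(2) by (intro continuous_map_eq[OF _ Suc.prems(1)]) simp_all
  ultimately show ?case unfolding Ck_on_Rd.simps by blast
qed

lemma partial_deriv_lincomb:
  assumes "\<And>y. y \<in> Rd d \<Longrightarrow> h y = a * f y + b * g y"
    and "Ck_on_Rd d (Suc k) f" "Ck_on_Rd d (Suc k) g" "i < d" "x \<in> Rd d"
  shows "(\<lambda>t. h (x(i := t))) differentiable (at (x i))"
    and "partial_deriv i h x = a * partial_deriv i f x + b * partial_deriv i g x"
proof -
  have "((\<lambda>t. a * f (x(i := t)) + b * g (x(i := t))) has_vector_derivative
      (a * partial_deriv i f x + b * partial_deriv i g x)) (at (x i))"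
    using assms unfolding partial_deriv_def
    by (intro has_vector_derivative_add has_vector_derivative_mult_right)
       (auto simp flip: vector_derivative_works)
  also have "(\<lambda>t. a * f (x(i := t)) + b * g (x(i := t))) = (\<lambda>t. h (x(i := t)))"
    using assms by (simp add: Rd_update)
  finally have *: "((\<lambda>t. h (x(i := t))) has_vector_derivative
      (a * partial_deriv i f x + b * partial_deriv i g x)) (at (x i))" .
  show "(\<lambda>t. h (x(i := t))) differentiable (at (x i))"
    using * by (rule differentiableI_vector)
  show "partial_deriv i h x = a * partial_deriv i f x + b * partial_deriv i g x"
    unfolding partial_deriv_def[of i h] using * by (rule vector_derivative_at)
qed

lemma continuous_map_lincomb:
  fixes f g :: "'a \<Rightarrow> complex"
  assumes "continuous_map X euclidean f" "continuous_map X euclidean g"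
    and "\<And>x. x \<in> topspace X \<Longrightarrow> h x = a * f x + b * g x"
  shows "continuous_map X euclidean h"
proof -
  have "continuous_map X euclidean (\<lambda>x. a * f x + b * g x)"
    using assms(1,2) by (auto simp: continuous_map_atin intro!: tendsto_intros)
  then show ?thesis
    using assms(3) by (auto intro: continuous_map_eq)
qed

lemma Ck_on_Rd_lincomb:
  assumes "\<And>y. y \<in> Rd d \<Longrightarrow> h y = a * f y + b * g y" "Ck_on_Rd d k f" "Ck_on_Rd d k g"
  shows "Ck_on_Rd d k h"
  using assms
proof (induction k arbitrary: f g h)
  case 0
  then show ?case
    using continuous_map_lincomb[of "Euclidean_space d" f g h a b] by simp
next
  case (Suc k)
  have "continuous_map (Euclidean_space d) euclidean h"
    using Suc.prems continuous_map_lincomb[of "Euclidean_space d" f g h a b] by simp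
  moreover have "Ck_on_Rd d k (partial_deriv i h)" if "i < d" for i
    using Suc.prems that
    by (intro Suc.IH[of "partial_deriv i h" "partial_deriv i f" "partial_deriv i g"]
        partial_deriv_lincomb[OF Suc.prems]) auto
  moreover have "(\<lambda>t. h (x(i := t))) differentiable (at (x i))" if "i < d" "x \<in> Rd d" for i x
    by (rule partial_deriv_lincomb(1)[OF Suc.prems that])
  ultimately show ?case
    unfolding Ck_on_Rd.simps by blast
qed

text \<open>
  The induction over a multi-index has to carry along that \<open>h\<close> is the combination only on
  \<open>\<real>\<^sup>d\<close>, and that \<open>f\<close> and \<open>g\<close> stay differentiable; this relation packages both.
\<close>

definition lincomb_Rd :: "nat \<Rightarrow> complex \<Rightarrow> complex \<Rightarrow> ((nat \<Rightarrow> real) \<Rightarrow> complex) \<Rightarrow>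
    ((nat \<Rightarrow> real) \<Rightarrow> complex) \<Rightarrow> ((nat \<Rightarrow> real) \<Rightarrow> complex) \<Rightarrow> bool" where
  "lincomb_Rd d a b f g h \<longleftrightarrow> (\<forall>k. Ck_on_Rd d k f) \<and> (\<forall>k. Ck_on_Rd d k g) \<and>
     (\<forall>x\<in>Rd d. h x = a * f x + b * g x)"

lemma lincomb_Rd_partial_deriv:
  assumes "lincomb_Rd d a b f g h" "i < d"
  shows "lincomb_Rd d a b (partial_deriv i f) (partial_deriv i g) (partial_deriv i h)"
proof -
  have f: "Ck_on_Rd d (Suc k) f" and g: "Ck_on_Rd d (Suc k) g" for k
    using assms(1) unfolding lincomb_Rd_def by blast+
  have h: "h y = a * f y + b * g y" if "y \<in> Rd d" for y
    using assms(1) that unfolding lincomb_Rd_def by blast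
  show ?thesis
    unfolding lincomb_Rd_def
    using f g partial_deriv_lincomb(2)[OF h f[of 0] g[of 0] assms(2)] assms(2) by auto
qed

lemma lincomb_Rd_mderiv:
  assumes "lincomb_Rd d a b f g h"
  shows "lincomb_Rd d a b (mderiv d \<beta> f) (mderiv d \<beta> g) (mderiv d \<beta> h)"
proof -
  have pow: "lincomb_Rd d a b ((partial_deriv i ^^ n) f) ((partial_deriv i ^^ n) g)
      ((partial_deriv i ^^ n) h)" if "lincomb_Rd d a b f g h" "i < d" for i n f g h
    using that by (induction n) (auto intro: lincomb_Rd_partial_deriv)
  have "set is \<subseteq> {..<d} \<Longrightarrow> lincomb_Rd d a b (foldr (\<lambda>i u. (partial_deriv i ^^ \<beta> i) u) is f)
     (foldr (\<lambda>i u. (partial_deriv i ^^ \<beta> i) u) is g) (foldr (\<lambda>i u. (partial_deriv i ^^ \<beta> i) u) is h)"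
    for "is"
    by (induction "is") (use assms pow in auto)
  from this[of "[0..<d]"] show ?thesis
    unfolding mderiv_def by (simp add: atLeast0LessThan)
qed

lemma smooth_Rd_lincomb:
  assumes "f \<in> smooth_Rd d" "g \<in> smooth_Rd d"
  shows "(\<lambda>x. a * f x + b * g x) \<in> smooth_Rd d"
proof -
  have "Ck_on_Rd d k (\<lambda>x. a * f x + b * g x)" for k
    using assms unfolding smooth_Rd_def
    by (intro Ck_on_Rd_lincomb[OF refl]) blast+
  then show ?thesis
    using assms by (simp add: smooth_Rd_def)
qed

lemma mderiv_lincomb:
  assumes "f \<in> smooth_Rd d" "g \<in> smooth_Rd d" "x \<in> Rd d"
  shows "mderiv d \<beta> (\<lambda>x. a * f x + b * g x) x = a * mderiv d \<beta> f x + b * mderiv d \<beta> g x"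
proof -
  have "lincomb_Rd d a b f g (\<lambda>x. a * f x + b * g x)"
    using assms unfolding lincomb_Rd_def smooth_Rd_def by blast
  from lincomb_Rd_mderiv[OF this] show ?thesis
    using assms(3) unfolding lincomb_Rd_def by blast
qed

section \<open>Comparison of the norms\<close>

lemma weight_seq_eq_conj_weight: "weight_seq \<omega> d \<mu> \<alpha> = conj_weight \<omega> \<mu> (mabs d \<alpha>)"
  by (simp add: weight_seq_def conj_weight_def)

lemma weight_denom_pos: "weight_denom G \<omega> d \<mu> \<alpha> \<beta> > 0"
  by (cases G) (simp_all add: weight_seq_eq_conj_weight conj_weight_pos)

text \<open>
  Extended nonnegative reals disappear here: finiteness of a norm is a pointwise estimate
  with a real constant.
\<close>

lemma gs_norm_le_iff:
  assumes "C \<ge> 0"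
  shows "gs_norm G \<omega> d \<mu> f \<le> ennreal C \<longleftrightarrow>
    (\<forall>\<alpha>\<in>multi_indices d. \<forall>\<beta>\<in>multi_indices d. \<forall>x\<in>Rd d.
       cmod (complex_of_real (mpow d x \<alpha>) * mderiv d \<beta> f x) \<le> C * weight_denom G \<omega> d \<mu> \<alpha> \<beta>)"
proof -
  have "S / ennreal w \<le> ennreal C \<longleftrightarrow> S \<le> ennreal (C * w)" if w: "w > 0" for S w
    using w assms
    by (cases S) (auto simp: divide_ennreal ennreal_le_iff pos_divide_le_eq ennreal_top_divide top_unique)
  then show ?thesis
    unfolding gs_norm_def sup_norm_def
    using assms by (auto simp: SUP_le_iff weight_denom_pos less_imp_le ennreal_le_iff)
qed

lemma gs_norm_finite_iff:
  "gs_norm G \<omega> d \<mu> f < \<infinity> \<longleftrightarrow> (\<exists>C\<ge>0. gs_norm G \<omega> d \<mu> f \<le> ennreal C)"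
  by (cases "gs_norm G \<omega> d \<mu> f") (auto simp: top_unique)

lemma weight_denom_mono:
  assumes "general_weight_function \<omega>" "0 < \<mu>" "\<mu> \<le> \<nu>"
  shows "weight_denom G \<omega> d \<mu> \<alpha> \<beta> \<le> weight_denom G \<omega> d \<nu> \<alpha> \<beta>"
  using assms conj_weight_pos[THEN less_imp_le]
  by (cases G) (auto simp: weight_seq_eq_conj_weight intro!: conj_weight_mono mult_mono)

text \<open>
  Separated growth multiplies two weights, so the constant of \<open>conj_weight_compare\<close> is squared;
  the squared constant also serves for joint growth.
\<close>

lemma weight_denom_compare:
  assumes \<sigma>: "general_weight_function \<sigma>" and \<mu>: "\<mu> > 0" and C: "C > 0"
    and le: "\<And>x. x \<ge> 1 \<Longrightarrow> \<sigma> x \<le> C * (\<omega> x + 1)"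
  shows "weight_denom G \<omega> d \<mu> \<alpha> \<beta> \<le> exp (2 / \<mu>) * weight_denom G \<sigma> d (C * \<mu>) \<alpha> \<beta>"
proof -
  note cmp = conj_weight_compare[OF \<sigma> \<mu> C le]
  show ?thesis
  proof (cases G)
    case Joint
    have "exp (1 / \<mu>) \<le> exp (2 / \<mu>)"
      using \<mu> by (simp add: divide_right_mono)
    then have "exp (1 / \<mu>) * conj_weight \<sigma> (C * \<mu>) n \<le> exp (2 / \<mu>) * conj_weight \<sigma> (C * \<mu>) n" for n
      by (intro mult_right_mono conj_weight_pos[THEN less_imp_le])
    with cmp show ?thesis
      unfolding Joint by (auto simp: weight_seq_eq_conj_weight intro: order_trans)
  next
    case Separated
    have "conj_weight \<omega> \<mu> m * conj_weight \<omega> \<mu> n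
        \<le> (exp (1 / \<mu>) * conj_weight \<sigma> (C * \<mu>) m) * (exp (1 / \<mu>) * conj_weight \<sigma> (C * \<mu>) n)" for m n
      using conj_weight_pos[THEN less_imp_le] by (intro mult_mono cmp) auto
    moreover have "exp (2 / \<mu>) = exp (1 / \<mu>) * exp (1 / \<mu>)"
      by (simp flip: exp_add)
    ultimately show ?thesis
      unfolding Separated by (simp add: weight_seq_eq_conj_weight mult_ac)
  qed
qed

lemma gs_norm_compare:
  assumes "general_weight_function \<sigma>" "\<mu> > 0" "C > 0"
    and "\<And>x. x \<ge> 1 \<Longrightarrow> \<sigma> x \<le> C * (\<omega> x + 1)"
  shows "gs_norm G \<sigma> d (C * \<mu>) f \<le> ennreal (exp (2 / \<mu>)) * gs_norm G \<omega> d \<mu> f"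
proof (cases "gs_norm G \<omega> d \<mu> f")
  case (real r)
  have "cmod (complex_of_real (mpow d x \<alpha>) * mderiv d \<beta> f x)
      \<le> exp (2 / \<mu>) * r * weight_denom G \<sigma> d (C * \<mu>) \<alpha> \<beta>"
    if "\<alpha> \<in> multi_indices d" "\<beta> \<in> multi_indices d" "x \<in> Rd d" for \<alpha> \<beta> x
  proof -
    have "cmod (complex_of_real (mpow d x \<alpha>) * mderiv d \<beta> f x) \<le> r * weight_denom G \<omega> d \<mu> \<alpha> \<beta>"
      using gs_norm_le_iff[of r G \<omega> d \<mu> f] real that by simp
    also have "\<dots> \<le> r * (exp (2 / \<mu>) * weight_denom G \<sigma> d (C * \<mu>) \<alpha> \<beta>)"
      using real by (intro mult_left_mono weight_denom_compare[OF assms]) auto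
    finally show ?thesis by (simp add: mult_ac)
  qed
  then have "gs_norm G \<sigma> d (C * \<mu>) f \<le> ennreal (exp (2 / \<mu>) * r)"
    using real by (subst gs_norm_le_iff) auto
  then show ?thesis
    using real by (simp add: ennreal_mult)
next
  case top
  then show ?thesis by (simp add: ennreal_mult_top)
qed

section \<open>Linearity of the spaces and continuity between inductive limits\<close>

definition complex_linear_space :: "('a \<Rightarrow> complex) set \<Rightarrow> bool" where
  "complex_linear_space E \<longleftrightarrow> (\<forall>f\<in>E. \<forall>g\<in>E. \<forall>a b. (\<lambda>x. a * f x + b * g x) \<in> E)"

text \<open>
  Two elements may live in different steps; since the weights increase with the parameter, both
  lie in the step with the larger one.
\<close>

lemma complex_linear_space_gs_space:
  assumes \<omega>: "general_weight_function \<omega>"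
  shows "complex_linear_space (gs_space G \<omega> d)"
  unfolding complex_linear_space_def
proof (intro ballI allI)
  fix f g a b
  assume f: "f \<in> gs_space G \<omega> d" and g: "g \<in> gs_space G \<omega> d"
  let ?h = "\<lambda>x. a * f x + b * g x"
  obtain \<mu>1 C1 where 1: "\<mu>1 > 0" "C1 \<ge> 0" "gs_norm G \<omega> d \<mu>1 f \<le> ennreal C1"
    using f unfolding gs_space_def gs_norm_finite_iff by blast
  obtain \<mu>2 C2 where 2: "\<mu>2 > 0" "C2 \<ge> 0" "gs_norm G \<omega> d \<mu>2 g \<le> ennreal C2"
    using g unfolding gs_space_def gs_norm_finite_iff by blast
  have smooth: "f \<in> smooth_Rd d" "g \<in> smooth_Rd d"
    using f g by (auto simp: gs_space_def)
  define \<mu> where "\<mu> = max \<mu>1 \<mu>2"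
  define C where "C = cmod a * C1 + cmod b * C2"
  have "C \<ge> 0" using 1 2 by (simp add: C_def)
  have "cmod (complex_of_real (mpow d x \<alpha>) * mderiv d \<beta> ?h x) \<le> C * weight_denom G \<omega> d \<mu> \<alpha> \<beta>"
    if mi: "\<alpha> \<in> multi_indices d" "\<beta> \<in> multi_indices d" and x: "x \<in> Rd d" for \<alpha> \<beta> x
  proof -
    let ?m = "complex_of_real (mpow d x \<alpha>)"
    let ?w = "\<lambda>\<mu>. weight_denom G \<omega> d \<mu> \<alpha> \<beta>"
    have "cmod (?m * mderiv d \<beta> f x) \<le> C1 * ?w \<mu>1"
      using gs_norm_le_iff[OF 1(2)] 1(3) mi x by blast
    also have "\<dots> \<le> C1 * ?w \<mu>"
      using 1 by (intro mult_left_mono weight_denom_mono[OF \<omega>]) (auto simp: \<mu>_def)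
    finally have A: "cmod a * cmod (?m * mderiv d \<beta> f x) \<le> cmod a * (C1 * ?w \<mu>)"
      by (intro mult_left_mono) auto
    have "cmod (?m * mderiv d \<beta> g x) \<le> C2 * ?w \<mu>2"
      using gs_norm_le_iff[OF 2(2)] 2(3) mi x by blast
    also have "\<dots> \<le> C2 * ?w \<mu>"
      using 2 by (intro mult_left_mono weight_denom_mono[OF \<omega>]) (auto simp: \<mu>_def)
    finally have B: "cmod b * cmod (?m * mderiv d \<beta> g x) \<le> cmod b * (C2 * ?w \<mu>)"
      by (intro mult_left_mono) auto
    have "?m * mderiv d \<beta> ?h x = a * (?m * mderiv d \<beta> f x) + b * (?m * mderiv d \<beta> g x)"
      by (simp add: mderiv_lincomb[OF smooth x] algebra_simps)
    then have "cmod (?m * mderiv d \<beta> ?h x)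
        \<le> cmod (a * (?m * mderiv d \<beta> f x)) + cmod (b * (?m * mderiv d \<beta> g x))"
      by (metis norm_triangle_ineq)
    also have "\<dots> \<le> cmod a * (C1 * ?w \<mu>) + cmod b * (C2 * ?w \<mu>)"
      unfolding norm_mult[of a] norm_mult[of b] by (rule add_mono[OF A B])
    also have "\<dots> = C * ?w \<mu>"
      by (simp only: C_def distrib_right mult.assoc)
    finally show ?thesis .
  qed
  then have "gs_norm G \<omega> d \<mu> ?h \<le> ennreal C"
    using gs_norm_le_iff[OF \<open>C \<ge> 0\<close>] by blast
  moreover have "\<mu> > 0" using 1 by (simp add: \<mu>_def)
  ultimately show "?h \<in> gs_space G \<omega> d"
    using \<open>C \<ge> 0\<close> smooth_Rd_lincomb[OF smooth] unfolding gs_space_def gs_norm_finite_iff by blast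
qed

lemma complex_linear_spaceD:
  assumes "complex_linear_space E" "f \<in> E"
  shows "(\<lambda>x. c * f x) \<in> E" "g \<in> E \<Longrightarrow> (\<lambda>x. f x + g x) \<in> E"
    "g \<in> E \<Longrightarrow> (\<lambda>x. a * f x + b * g x) \<in> E"
proof -
  have *: "(\<lambda>x. a * f x + b * g x) \<in> E" if "g \<in> E" for a b g
    using assms(1)[unfolded complex_linear_space_def, rule_format, OF assms(2) that] .
  then show "g \<in> E \<Longrightarrow> (\<lambda>x. a * f x + b * g x) \<in> E" .
  show "(\<lambda>x. c * f x) \<in> E" using *[OF assms(2), of c 0] by simp
  show "(\<lambda>x. f x + g x) \<in> E" if "g \<in> E" using *[OF that, of 1 1] by simp
qed

lemma lc_topology_subspace:
  assumes T: "lc_topology F T" and E: "complex_linear_space E" "E \<subseteq> F"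
  shows "lc_topology E (subtopology T E)"
proof -
  let ?S = "subtopology T E"
  have top: "topspace ?S = E"
    using T E by (auto simp: lc_topology_def)
  have id: "continuous_map ?S T id"
    by (simp add: continuous_map_from_subtopology)
  have "continuous_map (prod_topology ?S ?S) T (\<lambda>(f, g). \<lambda>x. f x + g x)"
  proof -
    have "continuous_map (prod_topology T T) T (\<lambda>(f, g). \<lambda>x. f x + g x)"
      using T by (simp add: lc_topology_def)
    then show ?thesis
      unfolding subtopology_Times[symmetric] by (rule continuous_map_from_subtopology)
  qed
  then have add: "continuous_map (prod_topology ?S ?S) ?S (\<lambda>(f, g). \<lambda>x. f x + g x)"
    using top complex_linear_spaceD[OF E(1)]
    by (auto simp: continuous_map_in_subtopology image_subset_iff)
  have "continuous_map (prod_topology euclidean ?S) T (\<lambda>(c, f). \<lambda>x. c * f x)"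
  proof -
    have "continuous_map (prod_topology euclidean T) T (\<lambda>(c, f). \<lambda>x. c * f x)"
      using T by (simp add: lc_topology_def)
    then show ?thesis
      unfolding prod_topology_subtopology(2) by (rule continuous_map_from_subtopology)
  qed
  then have mult: "continuous_map (prod_topology euclidean ?S) ?S (\<lambda>(c, f). \<lambda>x. c * f x)"
    using top complex_linear_spaceD[OF E(1)]
    by (auto simp: continuous_map_in_subtopology image_subset_iff)
  have convex: "\<exists>V. openin ?S V \<and> (\<lambda>x. 0) \<in> V \<and> V \<subseteq> U \<and>
      (\<forall>f\<in>V. \<forall>g\<in>V. \<forall>t\<in>{0..1::real}.
        (\<lambda>x. complex_of_real (1 - t) * f x + complex_of_real t * g x) \<in> V)"
    if U: "openin ?S U" "(\<lambda>x. 0) \<in> U" for U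
  proof -
    obtain U' where U': "openin T U'" "U = U' \<inter> E"
      using U(1) by (auto simp: openin_subtopology)
    have lc: "\<forall>U. openin T U \<and> (\<lambda>x. 0) \<in> U \<longrightarrow> (\<exists>V. openin T V \<and> (\<lambda>x. 0) \<in> V \<and> V \<subseteq> U \<and>
        (\<forall>f\<in>V. \<forall>g\<in>V. \<forall>t\<in>{0..1::real}.
          (\<lambda>x. complex_of_real (1 - t) * f x + complex_of_real t * g x) \<in> V))"
      using T unfolding lc_topology_def by (elim conjE)
    obtain V where V: "openin T V" "(\<lambda>x. 0) \<in> V" "V \<subseteq> U'"
        "\<And>f g t. f \<in> V \<Longrightarrow> g \<in> V \<Longrightarrow> t \<in> {0..1::real} \<Longrightarrow>
          (\<lambda>x. complex_of_real (1 - t) * f x + complex_of_real t * g x) \<in> V"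
      using lc[rule_format, of U'] U' U(2) by blast
    have "openin ?S (V \<inter> E)"
      using V(1) by (rule openin_subtopology_Int)
    moreover have "(\<lambda>x. 0) \<in> V \<inter> E" "V \<inter> E \<subseteq> U"
      using V U U' by auto
    moreover have "(\<lambda>x. complex_of_real (1 - t) * f x + complex_of_real t * g x) \<in> V \<inter> E"
      if "f \<in> V \<inter> E" "g \<in> V \<inter> E" "t \<in> {0..1}" for f g t
      using V(4) complex_linear_spaceD(3)[OF E(1)] that by (intro IntI) blast+
    ultimately show ?thesis by blast
  qed
  show ?thesis
    unfolding lc_topology_def by (intro conjI allI impI top add mult) (use convex in blast)
qed

text \<open>
  The pullback of any topology along a constant map is indiscrete.
\<close>

lemma continuous_map_into_indiscrete:
  assumes "\<And>y. y \<in> topspace X \<Longrightarrow> h y \<in> E"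
  shows "continuous_map X (pullback_topology E (\<lambda>_. 0::real) euclidean) h"
  using assms by (intro continuous_map_pullback') (auto simp: o_def)

text \<open>
  The inductive limit topology is generated by the open sets of certain locally convex
  topologies. The indiscrete one is always among them, so its carrier is the whole space.
\<close>

lemma lc_topology_indiscrete:
  assumes E: "complex_linear_space E"
  shows "\<exists>T. lc_topology E T \<and> (\<forall>X. topspace X \<subseteq> E \<longrightarrow> continuous_map X T (\<lambda>f. f))"
proof -
  let ?T = "pullback_topology E (\<lambda>_. 0::real) euclidean"
  have top: "topspace ?T = E"
    by (simp add: topspace_pullback_topology)
  have openT: "openin ?T U \<Longrightarrow> U = {} \<or> U = E" for U
    by (auto simp: openin_pullback_topology split: if_splits)
  have "lc_topology E ?T"
    unfolding lc_topology_def
  proof (intro conjI allI impI)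
    show "continuous_map (prod_topology ?T ?T) ?T (\<lambda>(f, g). \<lambda>x. f x + g x)"
      by (rule continuous_map_into_indiscrete) (use complex_linear_spaceD(2)[OF E] top in auto)
    show "continuous_map (prod_topology euclidean ?T) ?T (\<lambda>(c, f). \<lambda>x. c * f x)"
      by (rule continuous_map_into_indiscrete) (use complex_linear_spaceD(1)[OF E] top in auto)
    fix U assume U: "openin ?T U \<and> (\<lambda>x. 0) \<in> U"
    then have "U = E" using openT by blast
    have "(\<lambda>x. complex_of_real (1 - t) * f x + complex_of_real t * g x) \<in> E"
      if "f \<in> E" "g \<in> E" for f g and t :: real
      by (rule complex_linear_spaceD(3)[OF E that])
    with U show "\<exists>V. openin ?T V \<and> (\<lambda>x. 0) \<in> V \<and> V \<subseteq> U \<and>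
        (\<forall>f\<in>V. \<forall>g\<in>V. \<forall>t\<in>{0..1::real}.
          (\<lambda>x. complex_of_real (1 - t) * f x + complex_of_real t * g x) \<in> V)"
      unfolding \<open>U = E\<close> by blast
  qed (rule top)
  moreover have "continuous_map X ?T (\<lambda>f. f)" if "topspace X \<subseteq> E" for X
    using that by (intro continuous_map_into_indiscrete) auto
  ultimately show ?thesis by blast
qed

text \<open>
  A generating open set \<open>U\<close> of the limit on \<open>F\<close> is open for some admissible locally convex
  topology \<open>T\<close> on \<open>F\<close>. The trace of \<open>T\<close> on \<open>E\<close> is locally convex, and it is admissible for \<open>E\<close>
  because each step of \<open>E\<close> maps continuously into a step of \<open>F\<close>. Hence \<open>U \<inter> E\<close> is a generating
  open set of the limit on \<open>E\<close>.
\<close>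

lemma continuous_map_inductive_limit:
  assumes E: "complex_linear_space E" and F: "complex_linear_space F" and EF: "E \<subseteq> F"
    and SE: "\<And>i. i \<in> I \<Longrightarrow> topspace (S i) \<subseteq> E"
    and RF: "\<And>j. j \<in> J \<Longrightarrow> topspace (R j) \<subseteq> F"
    and step: "\<And>i. i \<in> I \<Longrightarrow> \<exists>j\<in>J. continuous_map (S i) (R j) (\<lambda>f. f)"
  shows "continuous_map (inductive_limit_topology E I S) (inductive_limit_topology F J R) (\<lambda>f. f)"
  unfolding inductive_limit_topology_def[of F]
proof (rule continuous_on_generated_topo)
  let ?L = "inductive_limit_topology E I S"
  have topL: "topspace ?L \<subseteq> E"
    unfolding inductive_limit_topology_def topology_generated_by_topspace
    by (auto simp: lc_topology_def dest: openin_subset)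
  fix U assume "U \<in> {U. \<exists>T. lc_topology F T \<and> (\<forall>j\<in>J. continuous_map (R j) T (\<lambda>f. f)) \<and> openin T U}"
  then obtain T where T: "lc_topology F T" "\<And>j. j \<in> J \<Longrightarrow> continuous_map (R j) T (\<lambda>f. f)" "openin T U"
    by blast
  have "lc_topology E (subtopology T E)"
    by (rule lc_topology_subspace[OF T(1) E EF])
  moreover have "continuous_map (S i) (subtopology T E) (\<lambda>f. f)" if i: "i \<in> I" for i
  proof -
    obtain j where "j \<in> J" "continuous_map (S i) (R j) (\<lambda>f. f)"
      using step[OF i] by blast
    then have "continuous_map (S i) T (\<lambda>f. f)"
      using continuous_map_compose[of "S i" "R j" "\<lambda>f. f" T "\<lambda>f. f"] T(2) by (simp add: o_def)
    then show ?thesis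
      using SE[OF i] by (auto simp: continuous_map_in_subtopology)
  qed
  moreover have "openin (subtopology T E) (U \<inter> E)"
    using T(3) by (rule openin_subtopology_Int)
  ultimately have "openin ?L (U \<inter> E)"
    unfolding inductive_limit_topology_def by (intro topology_generated_by_Basis) blast
  then have "openin ?L (U \<inter> E \<inter> topspace ?L)"
    by (rule openin_Int) simp
  moreover have "(\<lambda>f. f) -` U \<inter> topspace ?L = U \<inter> E \<inter> topspace ?L"
    using topL by auto
  ultimately show "openin ?L ((\<lambda>f. f) -` U \<inter> topspace ?L)"
    by simp
next
  obtain T where "lc_topology F T" "\<And>X. topspace X \<subseteq> F \<Longrightarrow> continuous_map X T (\<lambda>f. f)"
    using lc_topology_indiscrete[OF F] by blast
  then have "F \<in> {U. \<exists>T. lc_topology F T \<and> (\<forall>j\<in>J. continuous_map (R j) T (\<lambda>f. f)) \<and> openin T U}"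
    using RF by (auto simp: lc_topology_def)
  moreover have "topspace (inductive_limit_topology E I S) \<subseteq> E"
    unfolding inductive_limit_topology_def topology_generated_by_topspace
    by (auto simp: lc_topology_def dest: openin_subset)
  ultimately show "(\<lambda>f. f) ` topspace (inductive_limit_topology E I S) \<subseteq>
      \<Union> {U. \<exists>T. lc_topology F T \<and> (\<forall>j\<in>J. continuous_map (R j) T (\<lambda>f. f)) \<and> openin T U}"
    using EF by auto
qed

section \<open>A larger weight gives a smaller space\<close>

lemma topspace_gs_step: "topspace (gs_step_topology G \<omega> d \<mu>) = gs_step G \<omega> d \<mu>"
proof
  have "openin (gs_step_topology G \<omega> d \<mu>) (gs_step G \<omega> d \<mu>)"
    unfolding openin_gs_step_topology by (intro conjI ballI exI[of _ 1]) auto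
  then show "gs_step G \<omega> d \<mu> \<subseteq> topspace (gs_step_topology G \<omega> d \<mu>)"
    by (rule openin_subset)
  show "topspace (gs_step_topology G \<omega> d \<mu>) \<subseteq> gs_step G \<omega> d \<mu>"
    using openin_topspace[of "gs_step_topology G \<omega> d \<mu>"] unfolding openin_gs_step_topology by blast
qed

lemma gs_step_inclusion_continuous:
  assumes K: "K > 0"
    and le: "\<And>f. gs_norm G \<sigma> d \<nu> f \<le> ennreal K * gs_norm G \<omega> d \<mu> f"
  shows "continuous_map (gs_step_topology G \<omega> d \<mu>) (gs_step_topology G \<sigma> d \<nu>) (\<lambda>f. f)"
proof -
  have sub: "gs_step G \<omega> d \<mu> \<subseteq> gs_step G \<sigma> d \<nu>"
  proof
    fix f assume f: "f \<in> gs_step G \<omega> d \<mu>"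
    then have "ennreal K * gs_norm G \<omega> d \<mu> f < \<infinity>"
      by (simp add: gs_step_def ennreal_mult_less_top)
    with le[of f] f show "f \<in> gs_step G \<sigma> d \<nu>"
      by (auto simp: gs_step_def intro: le_less_trans)
  qed
  have "openin (gs_step_topology G \<omega> d \<mu>) {f \<in> gs_step G \<omega> d \<mu>. f \<in> U}"
    if U: "openin (gs_step_topology G \<sigma> d \<nu>) U" for U
    unfolding openin_gs_step_topology
  proof (intro conjI ballI)
    fix f assume f: "f \<in> {f \<in> gs_step G \<omega> d \<mu>. f \<in> U}"
    then obtain \<epsilon> where \<epsilon>: "\<epsilon> > 0"
        "\<And>g. g \<in> gs_step G \<sigma> d \<nu> \<Longrightarrow> gs_norm G \<sigma> d \<nu> (\<lambda>x. g x - f x) < ennreal \<epsilon> \<Longrightarrow> g \<in> U"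
      using U unfolding openin_gs_step_topology by blast
    have "gs_norm G \<sigma> d \<nu> h < ennreal \<epsilon>" if "gs_norm G \<omega> d \<mu> h < ennreal (\<epsilon> / K)" for h
    proof -
      have "ennreal K * gs_norm G \<omega> d \<mu> h < ennreal K * ennreal (\<epsilon> / K)"
        using K that by (intro ennreal_mult_strict_left_mono) auto
      also have "\<dots> = ennreal \<epsilon>"
        using K \<epsilon>(1) by (simp flip: ennreal_mult)
      finally show ?thesis using le[of h] by (rule le_less_trans[rotated])
    qed
    then show "\<exists>\<epsilon>>0. \<forall>g\<in>gs_step G \<omega> d \<mu>. gs_norm G \<omega> d \<mu> (\<lambda>x. g x - f x) < ennreal \<epsilon> \<longrightarrow>
        g \<in> {f \<in> gs_step G \<omega> d \<mu>. f \<in> U}"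
      using K \<epsilon> sub by (intro exI[of _ "\<epsilon> / K"]) auto
  qed auto
  with sub show ?thesis
    by (auto simp: continuous_map_def topspace_gs_step)
qed

text \<open>
  The asymptotic bound becomes a bound for all \<open>x \<ge> 1\<close>, because \<open>\<sigma>\<close> is bounded on the
  remaining interval.
\<close>

lemma weight_le_bound:
  assumes \<omega>: "general_weight_function \<omega>" and \<sigma>: "general_weight_function \<sigma>" and le: "\<omega> \<preceq>\<^sub>w \<sigma>"
  shows "\<exists>C>0. \<forall>x\<ge>1. \<sigma> x \<le> C * (\<omega> x + 1)"
proof -
  obtain c where c: "c > 0" "\<forall>\<^sub>F x in at_top. norm (\<sigma> x) \<le> c * norm (\<omega> x)"
    using le unfolding weight_le_def by (elim landau_o.bigE)
  then obtain T where T: "\<And>x. x \<ge> T \<Longrightarrow> \<bar>\<sigma> x\<bar> \<le> c * \<bar>\<omega> x\<bar>"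
    by (auto simp: eventually_at_top_linorder)
  define C where "C = c + \<sigma> (max T 1)"
  have S: "\<sigma> (max T 1) \<ge> 0"
    by (simp add: general_weight_nonneg[OF \<sigma>])
  have "\<sigma> x \<le> C * (\<omega> x + 1)" if x: "x \<ge> 1" for x
  proof -
    have nn: "\<omega> x \<ge> 0" using general_weight_nonneg[OF \<omega>, of x] x by simp
    have "\<sigma> x \<le> c * \<omega> x + \<sigma> (max T 1)"
    proof (cases "x \<ge> T")
      case True
      then show ?thesis using T[OF True] nn S by auto
    next
      case False
      then have "\<sigma> x \<le> \<sigma> (max T 1)"
        using x by (intro general_weight_mono[OF \<sigma>]) auto
      moreover have "0 \<le> c * \<omega> x" using c(1) nn by simp
      ultimately show ?thesis by simp
    qed
    also have "\<dots> \<le> C * (\<omega> x + 1)"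
      unfolding C_def using c(1) S nn by (simp add: algebra_simps)
    finally show ?thesis .
  qed
  moreover have "C > 0" using c(1) S by (simp add: C_def)
  ultimately show ?thesis by blast
qed

lemma gs_continuous_inclusion_if_weight_le:
  assumes \<omega>: "general_weight_function \<omega>" and \<sigma>: "general_weight_function \<sigma>" and le: "\<omega> \<preceq>\<^sub>w \<sigma>"
  shows "gs_continuous_inclusion G \<omega> \<sigma> d"
proof -
  obtain C where C: "C > 0" "\<And>x. x \<ge> 1 \<Longrightarrow> \<sigma> x \<le> C * (\<omega> x + 1)"
    using weight_le_bound[OF assms] by blast
  have cmp: "gs_norm G \<sigma> d (C * \<mu>) f \<le> ennreal (exp (2 / \<mu>)) * gs_norm G \<omega> d \<mu> f"
    if "\<mu> > 0" for \<mu> f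
    using gs_norm_compare[OF \<sigma> that C] by blast
  have sub: "gs_space G \<omega> d \<subseteq> gs_space G \<sigma> d"
  proof
    fix f assume "f \<in> gs_space G \<omega> d"
    then obtain \<mu> where f: "f \<in> smooth_Rd d" "\<mu> > 0" "gs_norm G \<omega> d \<mu> f < \<infinity>"
      by (auto simp: gs_space_def)
    have "gs_norm G \<sigma> d (C * \<mu>) f < \<infinity>"
      using cmp[OF f(2), of f] f(3) by (simp add: ennreal_mult_less_top le_less_trans)
    moreover have "C * \<mu> > 0" using C f by simp
    ultimately show "f \<in> gs_space G \<sigma> d" using f(1) by (auto simp: gs_space_def)
  qed
  have "continuous_map (gs_topology G \<omega> d) (gs_topology G \<sigma> d) (\<lambda>f. f)"
    unfolding gs_topology_def
  proof (rule continuous_map_inductive_limit)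
    fix \<mu> :: real assume \<mu>: "\<mu> \<in> {0<..}"
    have "continuous_map (gs_step_topology G \<omega> d \<mu>) (gs_step_topology G \<sigma> d (C * \<mu>)) (\<lambda>f. f)"
      using \<mu> by (intro gs_step_inclusion_continuous[OF _ cmp]) auto
    then show "\<exists>\<nu>\<in>{0<..}. continuous_map (gs_step_topology G \<omega> d \<mu>) (gs_step_topology G \<sigma> d \<nu>) (\<lambda>f. f)"
      using \<mu> C(1) by (intro bexI[of _ "C * \<mu>"]) auto
  qed (use sub complex_linear_space_gs_space \<omega> \<sigma> in
        \<open>auto simp: topspace_gs_step gs_step_def gs_space_def\<close>)
  with sub show ?thesis
    by (simp add: gs_continuous_inclusion_def)
qed

section \<open>Sums of Gaussian bumps\<close>

definition gauss_sum :: "(nat \<Rightarrow> real) \<Rightarrow> (nat \<Rightarrow> real) \<Rightarrow> complex \<Rightarrow> complex" where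
  "gauss_sum c a z = (\<Sum>j. of_real (c j) * exp (- (z - of_real (a j))\<^sup>2))"

lemma cmod_gauss: "cmod (exp (- (z - of_real a)\<^sup>2)) = exp ((Im z)\<^sup>2 - (Re z - a)\<^sup>2)"
  by (simp add: norm_exp_eq_Re power2_eq_square)

lemma cmod_gauss_le: "cmod (exp (- (z - of_real a)\<^sup>2)) \<le> exp ((Im z)\<^sup>2)"
  unfolding cmod_gauss by simp

text \<open>
  With \<open>z - x = u + i v\<close> and \<open>t = x - a\<close>, this is
  \<open>v\<^sup>2 - (t + u)\<^sup>2 = u\<^sup>2 + v\<^sup>2 - t\<^sup>2/2 - (t + 2u)\<^sup>2/2\<close>. Half of the Gaussian decay on the
  real line survives on a circle around \<open>x\<close>, at a price depending only on its radius.
\<close>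

lemma cmod_gauss_near_real:
  "cmod (exp (- (z - of_real a)\<^sup>2)) \<le> exp ((dist z (of_real x))\<^sup>2) * exp (- (x - a)\<^sup>2 / 2)"
proof -
  define u t where "u = Re z - x" and "t = x - a"
  have "(Im z)\<^sup>2 - (Re z - a)\<^sup>2 = (Im z)\<^sup>2 - (t + u)\<^sup>2"
    by (simp add: u_def t_def)
  also have "\<dots> = u\<^sup>2 + (Im z)\<^sup>2 - t\<^sup>2 / 2 - (t + 2 * u)\<^sup>2 / 2"
    by (simp add: power2_eq_square field_simps)
  also have "\<dots> \<le> u\<^sup>2 + (Im z)\<^sup>2 + - t\<^sup>2 / 2"
    by simp
  also have "u\<^sup>2 + (Im z)\<^sup>2 = (dist z (of_real x))\<^sup>2"
    by (simp add: dist_norm cmod_power2 u_def)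
  finally have "(Im z)\<^sup>2 - (Re z - a)\<^sup>2 \<le> (dist z (of_real x))\<^sup>2 + - (x - a)\<^sup>2 / 2"
    by (simp only: t_def)
  then show ?thesis
    by (simp only: cmod_gauss exp_add[symmetric] exp_le_cancel_iff)
qed

context
  fixes c a :: "nat \<Rightarrow> real"
  assumes c_nonneg: "\<And>j. c j \<ge> 0" and c_summable: "summable c"
begin

lemma gauss_sum_sums:
  "(\<lambda>j. of_real (c j) * exp (- (z - of_real (a j))\<^sup>2)) sums gauss_sum c a z"
proof -
  have "summable (\<lambda>j. of_real (c j) * exp (- (z - of_real (a j))\<^sup>2))"
  proof (rule summable_comparison_test')
    show "summable (\<lambda>j. c j * exp ((Im z)\<^sup>2))"
      by (intro summable_mult2 c_summable)
    show "norm (of_real (c j) * exp (- (z - of_real (a j))\<^sup>2)) \<le> c j * exp ((Im z)\<^sup>2)" for j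
      unfolding norm_mult norm_of_real abs_of_nonneg[OF c_nonneg]
      by (intro mult_left_mono cmod_gauss_le c_nonneg)
  qed
  then show ?thesis
    unfolding gauss_sum_def by (rule summable_sums)
qed

text \<open>
  On a unit ball the imaginary parts are bounded, so the series is dominated by a multiple of
  \<open>c\<close> there.
\<close>

lemma gauss_sum_holomorphic: "gauss_sum c a holomorphic_on UNIV"
proof -
  have "\<exists>g g'. \<forall>x\<in>(UNIV :: complex set). ((\<lambda>j. of_real (c j) * exp (- (x - of_real (a j))\<^sup>2)) sums g x) \<and>
      ((\<lambda>j. of_real (c j) * (exp (- (x - of_real (a j))\<^sup>2) * (- 2 * (x - of_real (a j))))) sums g' x) \<and>
      (g has_field_derivative g' x) (at x)"
  proof (rule series_and_derivative_comparison_local[OF open_UNIV])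
    fix j and x :: complex
    show "((\<lambda>x. of_real (c j) * exp (- (x - of_real (a j))\<^sup>2)) has_field_derivative
        of_real (c j) * (exp (- (x - of_real (a j))\<^sup>2) * (- 2 * (x - of_real (a j))))) (at x)"
      by (auto intro!: derivative_eq_intros)
  next
    fix x :: complex
    have "norm (of_real (c j) * exp (- (y - of_real (a j))\<^sup>2)) \<le> c j * exp ((\<bar>Im x\<bar> + 1)\<^sup>2)"
      if "y \<in> ball x 1" for j y
    proof -
      have "\<bar>Im y - Im x\<bar> \<le> 1"
        using that abs_Im_le_cmod[of "y - x"] by (simp add: dist_norm norm_minus_commute)
      then have "\<bar>Im y\<bar> \<le> \<bar>\<bar>Im x\<bar> + 1\<bar>" by linarith
      then have "(Im y)\<^sup>2 \<le> (\<bar>Im x\<bar> + 1)\<^sup>2" by (simp only: abs_le_square_iff)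
      then have "cmod (exp (- (y - of_real (a j))\<^sup>2)) \<le> exp ((\<bar>Im x\<bar> + 1)\<^sup>2)"
        using cmod_gauss_le[of y "a j"] by (meson exp_le_cancel_iff order_trans)
      then show ?thesis
        unfolding norm_mult norm_of_real abs_of_nonneg[OF c_nonneg]
        by (intro mult_left_mono c_nonneg)
    qed
    then show "\<exists>d h. 0 < d \<and> summable h \<and> (\<forall>\<^sub>F n in sequentially. \<forall>y\<in>ball x d \<inter> UNIV.
        norm (of_real (c n) * exp (- (y - of_real (a n))\<^sup>2)) \<le> h n)"
      by (intro exI[of _ 1] exI[of _ "\<lambda>j. c j * exp ((\<bar>Im x\<bar> + 1)\<^sup>2)"] conjI
          always_eventually summable_mult2 c_summable) auto
  qed
  then obtain g g' where g: "\<And>x :: complex. (\<lambda>j. of_real (c j) * exp (- (x - of_real (a j))\<^sup>2)) sums g x"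
      "\<And>x. (g has_field_derivative g' x) (at x)"
    by blast
  have "g = gauss_sum c a"
    using sums_unique2[OF g(1) gauss_sum_sums] by blast
  with g(2) show ?thesis
    using holomorphic_on_open[OF open_UNIV] by blast
qed

text \<open>
  Cauchy's inequality on the circle of radius \<open>r\<close> around \<open>x\<close> gives the bound
  \<open>n! exp (r\<^sup>2) / r^n\<close> times the sum. The radius \<open>r = \<surd>n\<close> is optimal up to geometric factors:
  then \<open>exp (r\<^sup>2) = e^n\<close> and \<open>sqrt (n!) \<le> r^n\<close>, which leaves one factor \<open>sqrt (n!)\<close>.
\<close>

lemma gauss_sum_deriv_bound:
  "cmod ((deriv ^^ n) (gauss_sum c a) (of_real x))
     \<le> exp 1 ^ n * sqrt (fact n) * (\<Sum>j. c j * exp (- (x - a j)\<^sup>2 / 2))"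
proof -
  define S where "S = (\<Sum>j. c j * exp (- (x - a j)\<^sup>2 / 2))"
  have S_summable: "summable (\<lambda>j. c j * exp (- (x - a j)\<^sup>2 / 2))"
    by (rule summable_comparison_test'[OF c_summable, of 0])
       (auto simp: c_nonneg abs_mult intro!: mult_left_le)
  have near: "cmod (gauss_sum c a z) \<le> exp (r\<^sup>2) * S" if "dist (of_real x) z = r" for z r
  proof -
    have le: "norm (of_real (c j) * exp (- (z - of_real (a j))\<^sup>2))
        \<le> exp (r\<^sup>2) * (c j * exp (- (x - a j)\<^sup>2 / 2))" for j
      using mult_left_mono[OF cmod_gauss_near_real[of z "a j" x] c_nonneg[of j]] that c_nonneg[of j]
      by (simp add: norm_mult dist_commute mult_ac)
    have sm: "summable (\<lambda>j. exp (r\<^sup>2) * (c j * exp (- (x - a j)\<^sup>2 / 2)))"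
      by (intro summable_mult S_summable)
    have "cmod (gauss_sum c a z) \<le> (\<Sum>j. exp (r\<^sup>2) * (c j * exp (- (x - a j)\<^sup>2 / 2)))"
      unfolding gauss_sum_def by (rule norm_suminf_le[OF le sm])
    also have "\<dots> = exp (r\<^sup>2) * S"
      unfolding S_def by (rule suminf_mult[OF S_summable])
    finally show ?thesis .
  qed
  show ?thesis
  proof (cases "n = 0")
    case True
    then show ?thesis using near[of "of_real x" 0] by (simp add: S_def)
  next
    case False
    define r where "r = sqrt n"
    have r: "r > 0" "r\<^sup>2 = n" using False by (auto simp: r_def)
    have "S \<ge> 0"
      unfolding S_def by (intro suminf_nonneg S_summable mult_nonneg_nonneg c_nonneg) auto
    have "cmod ((deriv ^^ n) (gauss_sum c a) (of_real x)) \<le> fact n * (exp (r\<^sup>2) * S) / r ^ n"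
    proof (rule Cauchy_inequality)
      show "gauss_sum c a holomorphic_on ball (of_real x) r"
        using gauss_sum_holomorphic by (rule holomorphic_on_subset) auto
      show "continuous_on (cball (of_real x) r) (gauss_sum c a)"
        using holomorphic_on_imp_continuous_on[OF gauss_sum_holomorphic]
        by (rule continuous_on_subset) auto
      show "cmod (gauss_sum c a z) \<le> exp (r\<^sup>2) * S" if "norm (of_real x - z) = r" for z
        by (rule near) (use that in \<open>simp add: dist_norm\<close>)
    qed (rule r(1))
    also have "\<dots> = (exp 1 ^ n * sqrt (fact n) * S) * (sqrt (fact n) / r ^ n)"
    proof -
      have e: "exp (r\<^sup>2) = exp 1 ^ n"
        by (simp add: r flip: exp_of_nat_mult)
      have f: "fact n = sqrt (fact n) * (sqrt (fact n) :: real)" by simp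
      show ?thesis
        unfolding e by (subst f) (simp only: times_divide_eq_right mult_ac)
    qed
    also have "\<dots> \<le> (exp 1 ^ n * sqrt (fact n) * S) * 1"
    proof (rule mult_left_mono)
      have "(fact n :: real) \<le> n ^ n"
        using fact_le_power[of n] by simp
      then have "sqrt (fact n) \<le> sqrt (n ^ n)" by (rule real_sqrt_le_mono)
      also have "\<dots> = r ^ n" by (simp add: r_def real_sqrt_power)
      finally show "sqrt (fact n) / r ^ n \<le> 1"
        using r by (simp add: pos_divide_le_eq)
      show "0 \<le> exp 1 ^ n * sqrt (fact n) * S"
        using \<open>S \<ge> 0\<close> by simp
    qed
    finally show ?thesis by (simp add: S_def)
  qed
qed

text \<open>
  On the real line all bumps are positive, so the one centred at \<open>a k\<close> is a lower bound.
\<close>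

lemma gauss_sum_lower: "c k \<le> cmod (gauss_sum c a (of_real (a k)))"
proof -
  have "(\<lambda>j. Re (of_real (c j) * exp (- (of_real (a k) - of_real (a j))\<^sup>2)))
      sums Re (gauss_sum c a (of_real (a k)))"
    by (rule sums_Re[OF gauss_sum_sums])
  also have "(\<lambda>j. Re (of_real (c j) * exp (- (of_real (a k) - of_real (a j))\<^sup>2)))
      = (\<lambda>j. c j * exp (- (a k - a j)\<^sup>2))"
    by (simp add: Re_exp power2_eq_square)
  finally have s: "(\<lambda>j. c j * exp (- (a k - a j)\<^sup>2)) sums Re (gauss_sum c a (of_real (a k)))" .
  have "(\<Sum>j\<in>{k}. c j * exp (- (a k - a j)\<^sup>2)) \<le> (\<Sum>j. c j * exp (- (a k - a j)\<^sup>2))"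
    by (rule sum_le_suminf) (use s in \<open>auto simp: c_nonneg sums_iff\<close>)
  also have "\<dots> = Re (gauss_sum c a (of_real (a k)))"
    using s by (simp add: sums_iff)
  also have "\<dots> \<le> cmod (gauss_sum c a (of_real (a k)))"
    by (rule complex_Re_le_cmod)
  finally show ?thesis by simp
qed

end

text \<open>
  The square of the claim is \<open>u^m / m! \<le> exp u\<close> for \<open>u = t\<^sup>2\<close>, one term of the exponential
  series.
\<close>

lemma power_times_gauss_le: "\<bar>t\<bar> ^ m * exp (- t\<^sup>2 / 2) \<le> sqrt (fact m)"
proof -
  have "(t\<^sup>2) ^ m / fact m \<le> exp (t\<^sup>2)"
    using exp_ge_zero sum_le_suminf[OF summable_exp[of "t\<^sup>2"], of "{m}"]
    by (simp add: exp_def divide_inverse scaleR_conv_of_real mult.commute)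
  then have "(t\<^sup>2) ^ m * exp (- t\<^sup>2) \<le> fact m"
    by (simp add: exp_minus divide_simps mult_ac)
  moreover have "(\<bar>t\<bar> ^ m * exp (- t\<^sup>2 / 2))\<^sup>2 = (t\<^sup>2) ^ m * exp (- t\<^sup>2)"
    by (simp add: power_mult_distrib power_mult[symmetric] mult.commute[of m] flip: exp_double)
       (simp add: power_mult)
  ultimately show ?thesis
    by (intro real_le_rsqrt) simp
qed

lemma power_times_shifted_gauss_le:
  "\<bar>x\<bar> ^ m * exp (- (x - a)\<^sup>2 / 2) \<le> 2 ^ m * (\<bar>a\<bar> ^ m + sqrt (fact m))"
proof -
  define M where "M = max \<bar>a\<bar> \<bar>x - a\<bar>"
  have "\<bar>a\<bar> \<le> M" "\<bar>x - a\<bar> \<le> M" by (simp_all add: M_def)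
  then have "\<bar>x\<bar> \<le> 2 * M" by linarith
  then have "\<bar>x\<bar> ^ m \<le> 2 ^ m * M ^ m"
    by (metis abs_ge_zero power_mono power_mult_distrib)
  also have "M ^ m \<le> \<bar>a\<bar> ^ m + \<bar>x - a\<bar> ^ m"
    by (simp add: M_def max_def)
  finally have "\<bar>x\<bar> ^ m \<le> 2 ^ m * (\<bar>a\<bar> ^ m + \<bar>x - a\<bar> ^ m)" by simp
  then have "\<bar>x\<bar> ^ m * exp (- (x - a)\<^sup>2 / 2)
      \<le> 2 ^ m * (\<bar>a\<bar> ^ m + \<bar>x - a\<bar> ^ m) * exp (- (x - a)\<^sup>2 / 2)"
    by (intro mult_right_mono) auto
  also have "\<dots> = 2 ^ m * (\<bar>a\<bar> ^ m * exp (- (x - a)\<^sup>2 / 2) + \<bar>x - a\<bar> ^ m * exp (- (x - a)\<^sup>2 / 2))"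
    by (simp only: mult.assoc distrib_right)
  also have "\<dots> \<le> 2 ^ m * (\<bar>a\<bar> ^ m + sqrt (fact m))"
    by (intro mult_left_mono add_mono power_times_gauss_le mult_left_le) auto
  finally show ?thesis .
qed

section \<open>A function decaying no faster than its weight allows\<close>

text \<open>
  The factor 2 in the heights leaves one factor \<open>exp (- \<omega> (2\<^sup>j))\<close> for summability after the
  other has been used to compensate a power of \<open>2\<^sup>j\<close>.
\<close>

definition dyadic_gauss_sum :: "(real \<Rightarrow> real) \<Rightarrow> complex \<Rightarrow> complex" where
  "dyadic_gauss_sum \<omega> = gauss_sum (\<lambda>j. exp (- 2 * \<omega> (2 ^ j))) (\<lambda>j. 2 ^ j)"

text \<open>
  By \<open>(\<gamma>)\<close>, \<open>exp (- \<omega> (2\<^sup>j)) \<le> exp (- ln (2\<^sup>j)) = 2\<^sup>-\<^sup>j\<close> for large \<open>j\<close>.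
\<close>

lemma summable_exp_weight_dyadic:
  assumes \<omega>: "general_weight_function \<omega>"
  shows "summable (\<lambda>j::nat. exp (- \<omega> (2 ^ j)))"
proof -
  obtain T where T: "T \<ge> 1" "\<And>x. x \<ge> T \<Longrightarrow> ln x \<le> 1 * \<omega> x"
    using weight_dominates_log[OF \<omega>, of 1] by auto
  obtain N where N: "T < 2 ^ N"
    using real_arch_pow[of 2 T] by auto
  show ?thesis
  proof (rule summable_comparison_test')
    show "summable (\<lambda>j. (1 / 2 :: real) ^ j)"
      by (rule summable_geometric) simp
    fix j assume "j \<ge> N"
    then have "(2::real) ^ N \<le> 2 ^ j" by (intro power_increasing) auto
    with N have "T \<le> 2 ^ j" by linarith
    from T(2)[OF this] have "ln (2 ^ j) \<le> \<omega> (2 ^ j)" by simp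
    then have "exp (- \<omega> (2 ^ j)) \<le> exp (- ln (2 ^ j))" by simp
    also have "\<dots> = inverse (2 ^ j)" by (simp add: exp_minus)
    also have "\<dots> = (1 / 2) ^ j" by (simp add: power_one_over inverse_eq_divide)
    finally show "norm (exp (- \<omega> (2 ^ j))) \<le> (1 / 2) ^ j" by simp
  qed
qed

lemma summable_dyadic_coeffs:
  assumes \<omega>: "general_weight_function \<omega>"
  shows "summable (\<lambda>j::nat. exp (- 2 * \<omega> (2 ^ j)))"
proof (rule summable_comparison_test'[OF summable_exp_weight_dyadic[OF \<omega>]])
  show "norm (exp (- 2 * \<omega> (2 ^ j))) \<le> exp (- \<omega> (2 ^ j))" for j :: nat
    using general_weight_nonneg[OF \<omega>, of "2 ^ j"] by simp
qed

text \<open>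
  The derivative contributes \<open>e^n * sqrt (n!)\<close>. A power \<open>x^m\<close> against a bump is at most
  \<open>2^m * (2\<^sup>j)^m\<close>, absorbed by one factor \<open>exp (- \<omega> (2\<^sup>j))\<close> of the height up to \<open>conj_weight \<omega> 1 m\<close>,
  plus \<open>2^m * sqrt (m!)\<close> from the tail of the bump.
\<close>

lemma dyadic_gauss_sum_bound:
  assumes \<omega>: "general_weight_function \<omega>"
  shows "\<exists>D\<ge>0. \<forall>m n x. \<bar>x\<bar> ^ m * cmod ((deriv ^^ n) (dyadic_gauss_sum \<omega>) (of_real x))
    \<le> D * (exp 1 ^ n * sqrt (fact n)) * (2 ^ m * (conj_weight \<omega> 1 m + sqrt (fact m)))"
proof -
  define D where "D = (\<Sum>j. exp (- \<omega> (2 ^ j)))"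
  note sum1 = summable_exp_weight_dyadic[OF \<omega>]
  have "D \<ge> 0" unfolding D_def by (intro suminf_nonneg sum1) auto
  define c where "c j = exp (- 2 * \<omega> (2 ^ j))" for j :: nat
  have c: "c j \<ge> 0" "summable c" for j
    using summable_dyadic_coeffs[OF \<omega>] by (auto simp: c_def[abs_def])
  have sum_le: "\<bar>x\<bar> ^ m * (\<Sum>j. c j * exp (- (x - 2 ^ j)\<^sup>2 / 2))
      \<le> D * (2 ^ m * (conj_weight \<omega> 1 m + sqrt (fact m)))" for x m
  proof -
    let ?B = "2 ^ m * (conj_weight \<omega> 1 m + sqrt (fact m))"
    have S_summable: "summable (\<lambda>j. c j * exp (- (x - 2 ^ j)\<^sup>2 / 2))"
      by (rule summable_comparison_test'[OF c(2), of 0])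
         (auto simp: c(1) abs_mult intro!: mult_left_le)
    have le: "\<bar>x\<bar> ^ m * (c j * exp (- (x - 2 ^ j)\<^sup>2 / 2)) \<le> exp (- \<omega> (2 ^ j)) * ?B" for j
    proof -
      have nn: "\<omega> (2 ^ j) \<ge> 0" using general_weight_nonneg[OF \<omega>] by simp
      have cj: "c j = exp (- \<omega> (2 ^ j)) * exp (- \<omega> (2 ^ j))"
        by (simp add: c_def flip: exp_add)
      have "\<bar>2 ^ j\<bar> ^ m * exp (- \<omega> (2 ^ j)) \<le> conj_weight \<omega> 1 m"
        using conj_weight_upper[OF \<omega>, of 1 "2 ^ j" m] by simp
      moreover have "sqrt (fact m) * exp (- \<omega> (2 ^ j)) \<le> sqrt (fact m)"
        using nn by (intro mult_left_le) auto
      ultimately have B: "exp (- \<omega> (2 ^ j)) * (\<bar>2 ^ j\<bar> ^ m + sqrt (fact m))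
          \<le> conj_weight \<omega> 1 m + sqrt (fact m)"
        by (simp only: distrib_left mult.commute[of "exp (- \<omega> (2 ^ j))"] add_mono)
      have "\<bar>x\<bar> ^ m * (c j * exp (- (x - 2 ^ j)\<^sup>2 / 2))
          = c j * (\<bar>x\<bar> ^ m * exp (- (x - 2 ^ j)\<^sup>2 / 2))"
        by (simp only: mult_ac)
      also have "\<dots> \<le> c j * (2 ^ m * (\<bar>2 ^ j\<bar> ^ m + sqrt (fact m)))"
        by (intro mult_left_mono power_times_shifted_gauss_le c(1))
      also have "\<dots> = exp (- \<omega> (2 ^ j)) * (2 ^ m *
          (exp (- \<omega> (2 ^ j)) * (\<bar>2 ^ j\<bar> ^ m + sqrt (fact m))))"
        unfolding cj by (simp only: mult_ac)
      also have "\<dots> \<le> exp (- \<omega> (2 ^ j)) * ?B"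
        by (intro mult_left_mono B) auto
      finally show ?thesis .
    qed
    have "\<bar>x\<bar> ^ m * (\<Sum>j. c j * exp (- (x - 2 ^ j)\<^sup>2 / 2))
        = (\<Sum>j. \<bar>x\<bar> ^ m * (c j * exp (- (x - 2 ^ j)\<^sup>2 / 2)))"
      by (rule suminf_mult[OF S_summable, symmetric])
    also have "\<dots> \<le> (\<Sum>j. exp (- \<omega> (2 ^ j)) * ?B)"
      by (intro suminf_le le summable_mult summable_mult2 S_summable sum1)
    also have "\<dots> = D * ?B"
      unfolding D_def by (rule suminf_mult2[OF sum1, symmetric])
    finally show ?thesis .
  qed
  have "\<bar>x\<bar> ^ m * cmod ((deriv ^^ n) (dyadic_gauss_sum \<omega>) (of_real x))
      \<le> D * (exp 1 ^ n * sqrt (fact n)) * (2 ^ m * (conj_weight \<omega> 1 m + sqrt (fact m)))" for x m n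
  proof -
    have "cmod ((deriv ^^ n) (dyadic_gauss_sum \<omega>) (of_real x))
        \<le> exp 1 ^ n * sqrt (fact n) * (\<Sum>j. c j * exp (- (x - 2 ^ j)\<^sup>2 / 2))"
      unfolding dyadic_gauss_sum_def c_def[abs_def, symmetric]
      by (rule gauss_sum_deriv_bound[OF c])
    then have "\<bar>x\<bar> ^ m * cmod ((deriv ^^ n) (dyadic_gauss_sum \<omega>) (of_real x))
        \<le> \<bar>x\<bar> ^ m * (exp 1 ^ n * sqrt (fact n) * (\<Sum>j. c j * exp (- (x - 2 ^ j)\<^sup>2 / 2)))"
      by (intro mult_left_mono) auto
    also have "\<dots> = exp 1 ^ n * sqrt (fact n) * (\<bar>x\<bar> ^ m * (\<Sum>j. c j * exp (- (x - 2 ^ j)\<^sup>2 / 2)))"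
      by (simp only: mult_ac)
    also have "\<dots> \<le> exp 1 ^ n * sqrt (fact n) * (D * (2 ^ m * (conj_weight \<omega> 1 m + sqrt (fact m))))"
      by (intro mult_left_mono sum_le) auto
    finally show ?thesis by (simp only: mult_ac)
  qed
  with \<open>D \<ge> 0\<close> show ?thesis by (intro exI[of _ D] conjI allI)
qed

lemma dyadic_gauss_sum_conj_weight_bound:
  assumes \<omega>: "weight_function \<omega>"
  shows "\<exists>\<nu>>0. \<exists>C\<ge>0. \<forall>m n x. \<bar>x\<bar> ^ m * cmod ((deriv ^^ n) (dyadic_gauss_sum \<omega>) (of_real x))
    \<le> C * (conj_weight \<omega> \<nu> m * conj_weight \<omega> \<nu> n)"
proof -
  have gen: "general_weight_function \<omega>"
    using \<omega> by (simp add: weight_function_def)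
  obtain D where D: "D \<ge> 0" "\<And>m n x. \<bar>x\<bar> ^ m * cmod ((deriv ^^ n) (dyadic_gauss_sum \<omega>) (of_real x))
    \<le> D * (exp 1 ^ n * sqrt (fact n)) * (2 ^ m * (conj_weight \<omega> 1 m + sqrt (fact m)))"
    using dyadic_gauss_sum_bound[OF gen] by blast
  obtain \<mu> A where A: "\<mu> > 0" "\<And>n. sqrt (fact n) \<le> A * conj_weight \<omega> \<mu> n"
    using sqrt_fact_le_conj_weight[OF \<omega>] by blast
  have "0 < sqrt (fact 0)" by simp
  also have "\<dots> \<le> A * conj_weight \<omega> \<mu> 0" by (rule A(2))
  finally have "A > 0" using conj_weight_pos[of \<omega> \<mu> 0] by (simp add: zero_less_mult_iff)
  \<comment> \<open>One parameter must serve for \<open>conj_weight \<omega> 1\<close> and for the bound of \<open>sqrt (fact n)\<close>.\<close>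
  define \<kappa> where "\<kappa> = max 1 \<mu>"
  have \<kappa>: "\<kappa> > 0" by (simp add: \<kappa>_def)
  have fact_le: "sqrt (fact n) \<le> A * conj_weight \<omega> \<kappa> n" for n
    using A(2)[of n] conj_weight_mono[OF gen A(1), of \<kappa> n] \<open>A > 0\<close>
    by (smt (verit) \<kappa>_def max.cobounded2 mult_left_mono)
  obtain \<nu> K where K: "\<nu> > 0" "\<And>n. exp 1 ^ n * conj_weight \<omega> \<kappa> n \<le> K * conj_weight \<omega> \<nu> n"
    using conj_weight_geometric[OF gen \<kappa>] by blast
  have "0 < exp 1 ^ 0 * conj_weight \<omega> \<kappa> 0" by (simp add: conj_weight_pos)
  also have "\<dots> \<le> K * conj_weight \<omega> \<nu> 0" by (rule K(2))
  finally have "K > 0" using conj_weight_pos[of \<omega> \<nu> 0] by (simp add: zero_less_mult_iff)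
  have n: "exp 1 ^ n * sqrt (fact n) \<le> A * K * conj_weight \<omega> \<nu> n" for n
  proof -
    have "exp 1 ^ n * sqrt (fact n) \<le> exp 1 ^ n * (A * conj_weight \<omega> \<kappa> n)"
      by (intro mult_left_mono fact_le) auto
    also have "\<dots> = A * (exp 1 ^ n * conj_weight \<omega> \<kappa> n)" by (simp only: mult_ac)
    also have "\<dots> \<le> A * (K * conj_weight \<omega> \<nu> n)"
      using \<open>A > 0\<close> by (intro mult_left_mono K) auto
    finally show ?thesis by (simp only: mult_ac)
  qed
  have m: "2 ^ m * (conj_weight \<omega> 1 m + sqrt (fact m)) \<le> (1 + A) * K * conj_weight \<omega> \<nu> m" for m
  proof -
    have "conj_weight \<omega> 1 m \<le> conj_weight \<omega> \<kappa> m"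
      by (rule conj_weight_mono[OF gen]) (auto simp: \<kappa>_def)
    then have "conj_weight \<omega> 1 m + sqrt (fact m) \<le> conj_weight \<omega> \<kappa> m + A * conj_weight \<omega> \<kappa> m"
      by (rule add_mono[OF _ fact_le])
    then have "2 ^ m * (conj_weight \<omega> 1 m + sqrt (fact m))
        \<le> exp 1 ^ m * (conj_weight \<omega> \<kappa> m + A * conj_weight \<omega> \<kappa> m)"
      using exp_ge_add_one_self[of 1] conj_weight_pos[of \<omega> 1 m]
      by (intro mult_mono power_mono) auto
    also have "\<dots> = (1 + A) * (exp 1 ^ m * conj_weight \<omega> \<kappa> m)"
      by (simp add: algebra_simps)
    also have "\<dots> \<le> (1 + A) * (K * conj_weight \<omega> \<nu> m)"
      using \<open>A > 0\<close> by (intro mult_left_mono K) auto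
    finally show ?thesis by (simp only: mult_ac)
  qed
  define C where "C = D * (A * K) * ((1 + A) * K)"
  have bound: "\<bar>x\<bar> ^ m * cmod ((deriv ^^ n) (dyadic_gauss_sum \<omega>) (of_real x))
      \<le> C * (conj_weight \<omega> \<nu> m * conj_weight \<omega> \<nu> n)" for x m n
  proof -
    have "\<bar>x\<bar> ^ m * cmod ((deriv ^^ n) (dyadic_gauss_sum \<omega>) (of_real x))
      \<le> D * (exp 1 ^ n * sqrt (fact n)) * (2 ^ m * (conj_weight \<omega> 1 m + sqrt (fact m)))"
      by (rule D(2))
    also have "\<dots> \<le> D * (A * K * conj_weight \<omega> \<nu> n) * ((1 + A) * K * conj_weight \<omega> \<nu> m)"
      using D(1) \<open>A > 0\<close> \<open>K > 0\<close> conj_weight_pos[of \<omega> 1 m] conj_weight_pos[of \<omega> \<nu> n]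
      by (intro mult_mono[OF mult_left_mono[OF n] m]) auto
    also have "\<dots> = C * (conj_weight \<omega> \<nu> m * conj_weight \<omega> \<nu> n)"
      unfolding C_def by (simp only: mult_ac)
    finally show ?thesis .
  qed
  have "C \<ge> 0"
    using D(1) \<open>A > 0\<close> \<open>K > 0\<close> by (simp add: C_def)
  with bound K(1) show ?thesis by blast
qed

text \<open>
  A function of one complex variable, restricted to the real line and read as a function on
  \<open>\<real>\<^sup>1\<close>, extended by 0 as the elements of \<open>smooth_Rd 1\<close> are.
\<close>

definition on_line :: "(complex \<Rightarrow> complex) \<Rightarrow> (nat \<Rightarrow> real) \<Rightarrow> complex" where
  "on_line F x = (if x \<in> Rd 1 then F (of_real (x 0)) else 0)"

lemma on_line_has_derivative:
  assumes "F holomorphic_on UNIV" "x \<in> Rd 1"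
  shows "((\<lambda>t. on_line F (x(0 := t))) has_vector_derivative on_line (deriv F) x) (at (x 0))"
proof -
  have "(F has_field_derivative deriv F (of_real (x 0))) (at (of_real (x 0)))"
    using assms(1) by (intro holomorphic_derivI) auto
  then have "((F \<circ> of_real) has_vector_derivative 1 * deriv F (of_real (x 0))) (at (x 0))"
    by (rule field_vector_diff_chain_at[rotated]) (auto intro!: derivative_eq_intros has_vector_derivative_of_real)
  moreover have "(\<lambda>t. on_line F (x(0 := t))) = F \<circ> of_real"
    using Rd_update[OF assms(2), of 0] by (auto simp: on_line_def)
  ultimately show ?thesis
    using assms(2) by (simp add: on_line_def)
qed

lemma partial_deriv_on_line:
  assumes "F holomorphic_on UNIV" "x \<in> Rd 1"
  shows "partial_deriv 0 (on_line F) x = on_line (deriv F) x"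
  unfolding partial_deriv_def by (rule vector_derivative_at[OF on_line_has_derivative[OF assms]])

lemma holomorphic_higher_deriv_UNIV:
  "F holomorphic_on UNIV \<Longrightarrow> (deriv ^^ n) F holomorphic_on UNIV"
  by (intro holomorphic_higher_deriv) auto

lemma continuous_map_on_line:
  assumes "F holomorphic_on UNIV"
  shows "continuous_map (Euclidean_space 1) euclidean (on_line F)"
proof -
  have "continuous_map (Euclidean_space 1) euclideanreal (\<lambda>x. x 0)"
    unfolding Euclidean_space_def
    by (intro continuous_map_from_subtopology continuous_map_product_projection) auto
  moreover have "continuous_map euclideanreal euclidean (\<lambda>t. F (of_real t))"
    using holomorphic_on_imp_continuous_on[OF assms]
    by (auto intro!: continuous_on_compose2[of UNIV F] continuous_intros)
  ultimately have "continuous_map (Euclidean_space 1) euclidean (\<lambda>x. F (of_real (x 0)))"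
    using continuous_map_compose[of "Euclidean_space 1" euclideanreal "\<lambda>x. x 0" euclidean
        "\<lambda>t. F (of_real t)"]
    by (simp add: o_def)
  then show ?thesis
    by (rule continuous_map_eq) (simp add: on_line_def)
qed

lemma Ck_on_line: "F holomorphic_on UNIV \<Longrightarrow> Ck_on_Rd 1 k (on_line F)"
proof (induction k arbitrary: F)
  case 0
  then show ?case
    unfolding Ck_on_Rd.simps by (rule continuous_map_on_line)
next
  case (Suc k)
  have "Ck_on_Rd 1 k (on_line (deriv F))"
    using Suc.prems by (intro Suc.IH holomorphic_deriv) auto
  then have "Ck_on_Rd 1 k (partial_deriv 0 (on_line F))"
    by (rule Ck_on_Rd_cong[rotated]) (rule partial_deriv_on_line[OF Suc.prems, symmetric])
  moreover have "(\<lambda>t. on_line F (x(0 := t))) differentiable (at (x 0))" if "x \<in> Rd 1" for x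
    by (rule differentiableI_vector[OF on_line_has_derivative[OF Suc.prems that]])
  ultimately show ?case
    unfolding Ck_on_Rd.simps less_one using continuous_map_on_line[OF Suc.prems] by blast
qed

lemma mderiv_on_line:
  assumes F: "F holomorphic_on UNIV" and x: "x \<in> Rd 1"
  shows "mderiv 1 \<beta> (on_line F) x = (deriv ^^ \<beta> 0) F (of_real (x 0))"
proof -
  have "(partial_deriv 0 ^^ n) (on_line F) x = on_line ((deriv ^^ n) F) x" if "x \<in> Rd 1" for n x
    using that
  proof (induction n arbitrary: x)
    case (Suc n)
    have "(partial_deriv 0 ^^ Suc n) (on_line F) x = partial_deriv 0 (on_line ((deriv ^^ n) F)) x"
      using Suc by (auto intro: partial_deriv_cong_Rd[of 1])
    then show ?case
      using partial_deriv_on_line[OF holomorphic_higher_deriv_UNIV[OF F] Suc.prems, of n] by simp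
  qed simp
  with x show ?thesis by (simp add: mderiv_def on_line_def)
qed

lemma mabs_1: "mabs 1 \<alpha> = \<alpha> 0" and mpow_1: "mpow 1 x \<alpha> = x 0 ^ \<alpha> 0"
  by (simp_all add: mabs_def mpow_def)

text \<open>
  The estimate above has the shape of separated growth; joint growth follows from
  \<open>conj_weight_mult_le\<close>.
\<close>

lemma dyadic_gauss_sum_in_gs_space:
  assumes \<omega>: "weight_function \<omega>"
  shows "on_line (dyadic_gauss_sum \<omega>) \<in> gs_space G \<omega> 1"
proof -
  have gen: "general_weight_function \<omega>"
    using \<omega> by (simp add: weight_function_def)
  have hol: "dyadic_gauss_sum \<omega> holomorphic_on UNIV"
    unfolding dyadic_gauss_sum_def by (intro gauss_sum_holomorphic summable_dyadic_coeffs[OF gen]) auto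
  obtain \<nu> C where \<nu>: "\<nu> > 0" and C: "C \<ge> 0"
    and bound: "\<And>m n x. \<bar>x\<bar> ^ m * cmod ((deriv ^^ n) (dyadic_gauss_sum \<omega>) (of_real x))
      \<le> C * (conj_weight \<omega> \<nu> m * conj_weight \<omega> \<nu> n)"
    using dyadic_gauss_sum_conj_weight_bound[OF \<omega>] by blast
  have denom: "conj_weight \<omega> \<nu> (\<alpha> 0) * conj_weight \<omega> \<nu> (\<beta> 0) \<le> weight_denom G \<omega> 1 \<nu> \<alpha> \<beta>" for \<alpha> \<beta>
    using conj_weight_mult_le[OF gen \<nu>]
    by (cases G) (auto simp: weight_seq_eq_conj_weight mabs_1[unfolded One_nat_def])
  have "gs_norm G \<omega> 1 \<nu> (on_line (dyadic_gauss_sum \<omega>)) \<le> ennreal C"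
    unfolding gs_norm_le_iff[OF C]
  proof (intro ballI)
    fix \<alpha> \<beta> x assume x: "x \<in> Rd 1"
    have "cmod (complex_of_real (mpow 1 x \<alpha>) * mderiv 1 \<beta> (on_line (dyadic_gauss_sum \<omega>)) x)
        = \<bar>x 0\<bar> ^ \<alpha> 0 * cmod ((deriv ^^ \<beta> 0) (dyadic_gauss_sum \<omega>) (of_real (x 0)))"
      unfolding mderiv_on_line[OF hol x] mpow_1 norm_mult norm_of_real power_abs ..
    also have "\<dots> \<le> C * (conj_weight \<omega> \<nu> (\<alpha> 0) * conj_weight \<omega> \<nu> (\<beta> 0))"
      by (rule bound)
    also have "\<dots> \<le> C * weight_denom G \<omega> 1 \<nu> \<alpha> \<beta>"
      by (rule mult_left_mono[OF denom C])
    finally show "cmod (complex_of_real (mpow 1 x \<alpha>) * mderiv 1 \<beta> (on_line (dyadic_gauss_sum \<omega>)) x)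
        \<le> C * weight_denom G \<omega> 1 \<nu> \<alpha> \<beta>" .
  qed
  moreover have "on_line (dyadic_gauss_sum \<omega>) \<in> smooth_Rd 1"
    unfolding smooth_Rd_def using Ck_on_line[OF hol] by (auto simp: on_line_def)
  ultimately show ?thesis
    using \<nu> C unfolding gs_space_def gs_norm_finite_iff by blast
qed

section \<open>Inclusion of the spaces forces comparison of the weights\<close>

text \<open>
  Only the estimates without derivatives are needed. For separated growth the weight of the
  derivative index 0 is a constant, possibly smaller than 1; the maxima make \<open>C\<close> work for both kinds
  of growth and make its logarithm nonnegative.
\<close>

lemma gs_space_decay:
  assumes "f \<in> gs_space G \<sigma> 1"
  shows "\<exists>\<mu>>0. \<exists>C\<ge>1. \<forall>x\<in>Rd 1. \<forall>n. \<bar>x 0\<bar> ^ n * cmod (f x) \<le> C * conj_weight \<sigma> \<mu> n"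
proof -
  obtain \<mu> C where \<mu>: "\<mu> > 0" and C: "C \<ge> 0" "gs_norm G \<sigma> 1 \<mu> f \<le> ennreal C"
    using assms unfolding gs_space_def gs_norm_finite_iff by blast
  define K where "K = max 1 (C * max 1 (conj_weight \<sigma> \<mu> 0))"
  have "\<bar>x 0\<bar> ^ n * cmod (f x) \<le> K * conj_weight \<sigma> \<mu> n" if x: "x \<in> Rd 1" for x n
  proof -
    define \<alpha> where "\<alpha> i = (if i = 0 then n else 0)" for i :: nat
    have mi: "\<alpha> \<in> multi_indices 1" "(\<lambda>_. 0) \<in> multi_indices 1"
      by (auto simp: multi_indices_def \<alpha>_def)
    have W: "conj_weight \<sigma> \<mu> n > 0" by (rule conj_weight_pos)
    have "\<bar>x 0\<bar> ^ n * cmod (f x) = cmod (complex_of_real (mpow 1 x \<alpha>) * mderiv 1 (\<lambda>_. 0) f x)"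
      unfolding mpow_1 by (simp add: mderiv_def \<alpha>_def norm_mult norm_power)
    also have "\<dots> \<le> C * weight_denom G \<sigma> 1 \<mu> \<alpha> (\<lambda>_. 0)"
      using gs_norm_le_iff[OF C(1)] C(2) mi x by blast
    also have "\<dots> \<le> C * (max 1 (conj_weight \<sigma> \<mu> 0) * conj_weight \<sigma> \<mu> n)"
    proof (rule mult_left_mono[OF _ C(1)])
      show "weight_denom G \<sigma> 1 \<mu> \<alpha> (\<lambda>_. 0) \<le> max 1 (conj_weight \<sigma> \<mu> 0) * conj_weight \<sigma> \<mu> n"
        using W mult_right_mono[of 1 "max 1 (conj_weight \<sigma> \<mu> 0)" "conj_weight \<sigma> \<mu> n"]
          mult_right_mono[of "conj_weight \<sigma> \<mu> 0" "max 1 (conj_weight \<sigma> \<mu> 0)" "conj_weight \<sigma> \<mu> n"]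
        by (cases G) (simp_all add: weight_seq_eq_conj_weight mabs_def \<alpha>_def mult.commute)
    qed
    also have "\<dots> \<le> K * conj_weight \<sigma> \<mu> n"
      unfolding mult.assoc[symmetric] using W by (intro mult_right_mono) (auto simp: K_def)
    finally show ?thesis .
  qed
  moreover have "K \<ge> 1" by (simp add: K_def)
  ultimately show ?thesis using \<mu> by blast
qed

lemma dyadic_above:
  assumes "(x::real) > 1"
  obtains j :: nat where "x \<le> 2 ^ j" "2 ^ j \<le> 2 * x"
proof -
  have ex: "\<exists>j. x \<le> 2 ^ j"
    using real_arch_pow[of 2 x] by (auto intro: less_imp_le)
  define j where "j = (LEAST j. x \<le> 2 ^ j)"
  have le: "x \<le> 2 ^ j"
    unfolding j_def by (rule LeastI_ex[OF ex])
  moreover obtain i where i: "j = Suc i"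
    using le assms by (cases j) auto
  moreover have "\<not> x \<le> 2 ^ i"
    by (rule not_less_Least[of i "\<lambda>j. x \<le> 2 ^ j", folded j_def]) (simp add: i)
  ultimately show ?thesis
    by (intro that[of j]) auto
qed

text \<open>
  At \<open>y = 2\<^sup>j\<close> the function is at least \<open>exp (- 2 \<omega> y)\<close>, while its decay as an element of the
  space of \<open>\<sigma>\<close>, with the exponent from \<open>conj_weight_biconjugate\<close>, bounds it by
  \<open>C y exp (- \<sigma> y / \<mu>)\<close>. Since \<open>ln y = o(\<omega> y)\<close>, this gives \<open>\<sigma> = O(\<omega>)\<close> along powers of two;
  monotonicity of \<open>\<sigma>\<close> and doubling of \<open>\<omega>\<close> fill the gaps.
\<close>

lemma weight_le_if_gs_space_subset:
  assumes \<omega>: "weight_function \<omega>" and \<sigma>: "weight_function \<sigma>"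
    and sub: "gs_space G \<omega> 1 \<subseteq> gs_space G \<sigma> 1"
  shows "\<omega> \<preceq>\<^sub>w \<sigma>"
proof -
  have gen: "general_weight_function \<omega>" "general_weight_function \<sigma>"
    using \<omega> \<sigma> by (auto simp: weight_function_def)
  obtain \<mu> C where \<mu>: "\<mu> > 0" and C: "C \<ge> 1"
    and decay: "\<And>x n. x \<in> Rd 1 \<Longrightarrow>
      \<bar>x 0\<bar> ^ n * cmod (on_line (dyadic_gauss_sum \<omega>) x) \<le> C * conj_weight \<sigma> \<mu> n"
    using gs_space_decay[OF subsetD[OF sub dyadic_gauss_sum_in_gs_space[OF \<omega>]]] by blast
  have dyadic: "\<sigma> (2 ^ j) \<le> \<mu> * (ln C + ln (2 ^ j) + 2 * \<omega> (2 ^ j))" if y: "(2::real) ^ j > 1" for j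
  proof -
    let ?y = "2 ^ j :: real"
    obtain n where n: "conj_weight \<sigma> \<mu> n * exp (\<sigma> ?y / \<mu>) \<le> ?y ^ Suc n"
      using conj_weight_biconjugate[OF gen(2) \<mu> y] ..
    define x :: "nat \<Rightarrow> real" where "x i = (if i = 0 then ?y else 0)" for i
    have x: "x \<in> Rd 1" "x 0 = ?y"
      by (auto simp: x_def topspace_Euclidean_space)
    have "exp (- 2 * \<omega> ?y) \<le> cmod (on_line (dyadic_gauss_sum \<omega>) x)"
      using gauss_sum_lower[OF exp_ge_zero summable_dyadic_coeffs[OF gen(1)], of j "\<lambda>j. 2 ^ j"] x
      by (simp add: on_line_def dyadic_gauss_sum_def)
    then have "?y ^ n * exp (- 2 * \<omega> ?y) \<le> ?y ^ n * cmod (on_line (dyadic_gauss_sum \<omega>) x)"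
      by (intro mult_left_mono) auto
    also have "\<dots> \<le> C * conj_weight \<sigma> \<mu> n"
      using decay[OF x(1), of n] x(2) by simp
    finally have "?y ^ n * exp (- 2 * \<omega> ?y) * exp (\<sigma> ?y / \<mu>)
        \<le> C * conj_weight \<sigma> \<mu> n * exp (\<sigma> ?y / \<mu>)"
      by (intro mult_right_mono) auto
    also have "\<dots> \<le> C * ?y ^ Suc n"
      unfolding mult.assoc using C n by (intro mult_left_mono) auto
    finally have "?y ^ n * (exp (- 2 * \<omega> ?y) * exp (\<sigma> ?y / \<mu>)) \<le> ?y ^ n * (C * ?y)"
      by (simp only: mult_ac power_Suc)
    then have "exp (- 2 * \<omega> ?y) * exp (\<sigma> ?y / \<mu>) \<le> C * ?y"
      by (subst (asm) mult_le_cancel_left_pos) auto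
    also have "C * ?y = exp (ln C + ln ?y)"
      using C by (simp add: exp_add)
    finally have "- 2 * \<omega> ?y + \<sigma> ?y / \<mu> \<le> ln C + ln ?y"
      by (simp only: exp_add[symmetric] exp_le_cancel_iff)
    then have "\<sigma> ?y / \<mu> \<le> ln C + ln ?y + 2 * \<omega> ?y"
      by simp
    then show ?thesis
      using \<mu> by (simp only: pos_divide_le_eq mult.commute[of \<mu>])
  qed
  obtain T where T: "T \<ge> 1" "\<And>x. x \<ge> T \<Longrightarrow> ln x \<le> 1 * \<omega> x"
    using weight_dominates_log[OF gen(1), of 1] by auto
  obtain L where L: "L \<ge> 1" "\<And>t. t \<ge> 0 \<Longrightarrow> \<omega> (2 * t) \<le> L * (\<omega> t + 1)"
    using general_weight_doubling[OF gen(1)] by blast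
  \<comment> \<open>As \<open>ln (2\<^sup>j) \<le> \<omega> (2\<^sup>j)\<close>, three copies of \<open>\<omega> (2\<^sup>j)\<close> occur,
    each at most \<open>L (\<omega> x + 1) \<le> 2 L \<omega> x\<close>.\<close>
  define K where "K = \<mu> * (ln C + 6 * L)"
  have "\<sigma> x \<le> K * \<omega> x" if x: "x \<ge> max T (exp 1)" for x
  proof -
    have x1: "x > 1" "x \<ge> T" "x \<ge> exp 1"
      using x exp_ge_add_one_self[of 1] by auto
    have "1 \<le> ln x"
      using x1 by (simp add: ln_ge_iff)
    then have \<omega>1: "\<omega> x \<ge> 1"
      using T(2)[OF x1(2)] by simp
    obtain j where j: "x \<le> 2 ^ j" "2 ^ j \<le> 2 * x"
      using dyadic_above[OF x1(1)] by blast
    have "\<omega> (2 ^ j) \<le> \<omega> (2 * x)"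
      using j by (intro general_weight_mono[OF gen(1)]) auto
    also have "\<dots> \<le> L * (\<omega> x + 1)"
      using L(2)[of x] x1 by simp
    also have "\<dots> \<le> L * (2 * \<omega> x)"
      using L(1) \<omega>1 by (intro mult_left_mono) auto
    finally have \<omega>j: "\<omega> (2 ^ j) \<le> 2 * L * \<omega> x" by simp
    have "ln C \<ge> 0" using C by simp
    have "\<sigma> x \<le> \<sigma> (2 ^ j)"
      using j x1 by (intro general_weight_mono[OF gen(2)]) auto
    also have "\<dots> \<le> \<mu> * (ln C + ln (2 ^ j) + 2 * \<omega> (2 ^ j))"
      using j x1 by (intro dyadic) auto
    also have "\<dots> \<le> \<mu> * (ln C * \<omega> x + 3 * (2 * L * \<omega> x))"
    proof (rule mult_left_mono)
      have "ln C * 1 \<le> ln C * \<omega> x"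
        using \<open>ln C \<ge> 0\<close> \<omega>1 by (rule mult_left_mono[rotated])
      moreover have "ln (2 ^ j) \<le> \<omega> (2 ^ j)"
        using T(2)[of "2 ^ j"] j x1 by simp
      ultimately show "ln C + ln (2 ^ j) + 2 * \<omega> (2 ^ j) \<le> ln C * \<omega> x + 3 * (2 * L * \<omega> x)"
        using \<omega>j by linarith
    qed (use \<mu> in simp)
    also have "\<dots> = K * \<omega> x"
      by (simp add: K_def algebra_simps)
    finally show ?thesis .
  qed
  moreover have "\<bar>\<sigma> x\<bar> = \<sigma> x" "\<bar>\<omega> x\<bar> = \<omega> x" if "x \<ge> max T (exp 1)" for x
    using that T(1) general_weight_nonneg[OF gen(1), of x] general_weight_nonneg[OF gen(2), of x] by auto
  ultimately have "\<forall>\<^sub>F x in at_top. norm (\<sigma> x) \<le> K * norm (\<omega> x)"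
    unfolding eventually_at_top_linorder by (intro exI[of _ "max T (exp 1)"]) auto
  then show ?thesis
    unfolding weight_le_def by (rule bigoI)
qed

theorem theorem4p1:
  fixes \<omega> \<sigma> :: "real \<Rightarrow> real"
  shows
    "(weight_function \<omega> \<and> weight_function \<sigma> \<longrightarrow>
        (\<forall>G. \<omega> \<preceq>\<^sub>w \<sigma> \<longleftrightarrow> (\<forall>d\<ge>1. gs_continuous_inclusion G \<omega> \<sigma> d))) \<and>
     (general_weight_function \<omega> \<and> general_weight_function \<sigma> \<longrightarrow>
        (\<forall>G. \<omega> \<preceq>\<^sub>w \<sigma> \<longrightarrow> (\<forall>d\<ge>1. gs_continuous_inclusion G \<omega> \<sigma> d))) \<and>
     (weight_function \<omega> \<and> weight_function \<sigma> \<longrightarrow>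
        (\<forall>G. gs_space G \<omega> 1 \<subseteq> gs_space G \<sigma> 1 \<longrightarrow> \<omega> \<preceq>\<^sub>w \<sigma>))"
proof -
  have suff: "gs_continuous_inclusion G \<omega> \<sigma> d"
    if "general_weight_function \<omega>" "general_weight_function \<sigma>" "\<omega> \<preceq>\<^sub>w \<sigma>" for G d
    using that by (rule gs_continuous_inclusion_if_weight_le)
  have nec: "\<omega> \<preceq>\<^sub>w \<sigma>"
    if "weight_function \<omega>" "weight_function \<sigma>" "gs_space G \<omega> 1 \<subseteq> gs_space G \<sigma> 1" for G
    using that by (rule weight_le_if_gs_space_subset)
  have "gs_space G \<omega> 1 \<subseteq> gs_space G \<sigma> 1" if "\<forall>d\<ge>1. gs_continuous_inclusion G \<omega> \<sigma> d" for G
    using that unfolding gs_continuous_inclusion_def by blast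
  with suff nec show ?thesis
    unfolding weight_function_def by blast
qed

end
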